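(* Fix $n\ge1$ and suppose that for each $0\le k\leq n$ we are given a Galois structure $\Gamma_k=(\mathcal{C}_k,\mathcal{B}_k,F_k,\mathrm{I}_k,\eta^k,\epsilon^k,\mathcal{E}_{k+1})$ which is strongly $\mathcal{E}_{k+1}$-Birkhoff, where $\mathcal{C}_k$ is the category of $k$-fold extensions over the Barr exact category $\mathcal{C}_0$ and, for $k\ge1$, $\mathcal{B}_k=\mathsf{Cov}(\mathcal{C}_{k-1})$ is the category of $\Gamma_{k-1}$-coverings. Let $\mathcal{B}_{n+1}=\mathsf{Cov}(\mathcal{C}_n)$ be the category of $\Gamma_n$-coverings, and suppose that $\mathcal{B}_{n+1}$ is $\mathcal{E}_{n+2}$-reflective in $\mathcal{C}_{n+1}$, with inclusion $\mathrm{I}_{n+1}$ and reflector $F_{n+1}$. Then the adjunction $F_{n+1}\dashv\mathrm{I}_{n+1}$ is $\mathcal{E}_{n+2}$-Birkhoff if and only if $\mathcal{B}_{n+1}$ is closed under quotients along $(n+2)$-fold extensions in $\mathcal{C}_{n+1}$.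
   Context: **Higher extensions.** $\mathcal{C}_0$ is a Barr exact category and $\mathcal{E}_1$ is the class of regular epimorphisms in $\mathcal{C}_0$. For a category $\mathcal{Y}$, a morphism $\alpha\colon f_A\to f_B$ in the arrow category $\mathsf{Arr}(\mathcal{Y})$, from $f_A\colon A_\top\to A_\perp$ to $f_B\colon B_\top\to B_\perp$, is a pair $(\alpha_\top\colon A_\top\to B_\top,\ \alpha_\perp\colon A_\perp\to B_\perp)$ with $f_B\circ\alpha_\top=\alpha_\perp\circ f_A$. For a class $\mathcal{E}$ of morphisms of $\mathcal{Y}$, this square is an $\mathcal{E}$-double extension when $\alpha_\top,\alpha_\perp,f_A,f_B$, the projections of the pullback $A_\perp\times_{B_\perp}B_\top$, and the comparison map $A_\top\to A_\perp\times_{B_\perp}B_\top$ are all in $\mathcal{E}$. Inductively, for $m\ge1$, $\mathcal{C}_m=\mathsf{Ext}^m(\mathcal{C}_0)$ is the full subcategory of $\mathsf{Arr}^m(\mathcal{C}_0)$ whose objects are the elements of $\mathcal{E}_m$ (the $m$-fold extensions), and $\mathcal{E}_{m+1}$ is the class of morphisms of $\mathcal{C}_m$ whose underlying square in $\mathcal{C}_{m-1}$ is an $\mathcal{E}_m$-double extension (the $(m+1)$-fold extensions). **Reflectivity and Birkhoff conditions.** Given a category $\mathcal{Y}$ with a class of extensions $\mathcal{E}$, an $\mathcal{E}$-reflective subcategory is a full replete subcategory $\mathrm{I}\colon\mathcal{X}\to\mathcal{Y}$ whose inclusion has a left adjoint $L$ such that all components $\eta_Y\colon Y\to \mathrm{I}L(Y)$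 of the unit are in $\mathcal{E}$. The adjunction is $\mathcal{E}$-Birkhoff when for each extension $f\colon A\to B$ the reflection square with sides $f$, $\eta_A$, $\eta_B$, $\mathrm{I}L(f)$ is a pushout in $\mathcal{Y}$; it is strongly $\mathcal{E}$-Birkhoff when for each such $f$ the reflection square is an $\mathcal{E}$-double extension. $\mathcal{X}$ is closed under quotients along extensions when, for any extension $A\to B$ with $A$ in $\mathcal{X}$, also $B$ is in $\mathcal{X}$. **Galois structures and coverings.** A Galois structure $\Gamma=(\mathcal{Y},\mathcal{X},L,\mathrm{I},\eta,\epsilon,\mathcal{E})$ consists of a category $\mathcal{Y}$ with a class of extensions $\mathcal{E}$ and a full replete subcategory $\mathcal{X}$ of $\mathcal{Y}$ whose inclusion $\mathrm{I}\colon\mathcal{X}\to\mathcal{Y}$ has a left adjoint $L\colon\mathcal{Y}\to\mathcal{X}$ with unit $\eta$ and counit $\epsilon$, such that all components $\eta_Y\colon Y\to\mathrm{I}L(Y)$ of the unit are in $\mathcal{E}$ (so that $\mathcal{X}$ is $\mathcal{E}$-reflective in $\mathcal{Y}$), where $\mathcal{E}$ is a class of regular epimorphisms such that: $\mathcal{E}$ contains all isomorphisms and is closed under composition; $L$ sends extensions to extensions; pullbacks along extensions exist and a pullback of an extension is an extension; every extension $e\colon Q\to B$ is of effective $\mathcal{E}$-descent, i.e. the pullback functor $e^*\colon\mathsf{Ext}(B)\to\mathsf{Ext}(Q)$ is monadic, where $\mathsf{Ext}(B)$ is the full subcategory of the slice over $B$ on the extensions. A trivial $\Gamma$-covering is an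 extension whose reflection square is a pullback. A $\Gamma$-covering is an extension $c\colon A\to B$ for which there is an extension $e\colon Q\to B$ such that the pullback of $c$ along $e$ is a trivial $\Gamma$-covering. $\mathsf{Cov}(\mathcal{Y})$ is the full subcategory of $\mathsf{Ext}(\mathcal{Y})$ determined by the $\Gamma$-coverings. *)

theory Defs
  imports Main
begin

section \<open>Categories\<close>

record ('o, 'm) category =
  Ob :: "'o set"
  Mor :: "'m set"
  Dom :: "'m \<Rightarrow> 'o"
  Cod :: "'m \<Rightarrow> 'o"
  Idn :: "'o \<Rightarrow> 'm"
  Comp :: "'m \<Rightarrow> 'm \<Rightarrow> 'm" (infixl "\<cdot>\<index>" 70)

definition hom :: "('o, 'm) category \<Rightarrow> 'o \<Rightarrow> 'o \<Rightarrow> 'm set" where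
  "hom C a b = {f \<in> Mor C. Dom C f = a \<and> Cod C f = b}"

locale category =
  fixes C :: "('o, 'm) category" (structure)
  assumes Dom_closed: "f \<in> Mor C \<Longrightarrow> Dom C f \<in> Ob C"
    and Cod_closed: "f \<in> Mor C \<Longrightarrow> Cod C f \<in> Ob C"
    and Idn_hom: "a \<in> Ob C \<Longrightarrow> Idn C a \<in> hom C a a"
    and Comp_hom: "\<lbrakk>f \<in> hom C a b; g \<in> hom C b c\<rbrakk> \<Longrightarrow> g \<cdot> f \<in> hom C a c"
    and Comp_Idn: "f \<in> hom C a b \<Longrightarrow> f \<cdot> Idn C a = f"
    and Idn_Comp: "f \<in> hom C a b \<Longrightarrow> Idn C b \<cdot> f = f"
    and Comp_assoc:
      "\<lbrakk>f \<in> hom C a b; g \<in> hom C b c; h \<in> hom C c d\<rbrakk> \<Longrightarrow> (h \<cdot> g) \<cdot> f = h \<cdot> (g \<cdot> f)"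

definition iso :: "('o, 'm) category \<Rightarrow> 'm \<Rightarrow> bool" where
  "iso C f \<longleftrightarrow> f \<in> Mor C \<and>
     (\<exists>g \<in> hom C (Cod C f) (Dom C f).
        g \<cdot>\<^bsub>C\<^esub> f = Idn C (Dom C f) \<and> f \<cdot>\<^bsub>C\<^esub> g = Idn C (Cod C f))"

definition is_coequalizer :: "('o, 'm) category \<Rightarrow> 'm \<Rightarrow> 'm \<Rightarrow> 'm \<Rightarrow> bool" where
  "is_coequalizer C u v f \<longleftrightarrow>
     u \<in> Mor C \<and> v \<in> Mor C \<and> f \<in> Mor C \<and>
     Dom C u = Dom C v \<and> Cod C u = Dom C f \<and> Cod C v = Dom C f \<and>
     f \<cdot>\<^bsub>C\<^esub> u = f \<cdot>\<^bsub>C\<^esub> v \<and>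
     (\<forall>g \<in> Mor C. Dom C g = Dom C f \<and> g \<cdot>\<^bsub>C\<^esub> u = g \<cdot>\<^bsub>C\<^esub> v \<longrightarrow>
        (\<exists>!w. w \<in> hom C (Cod C f) (Cod C g) \<and> w \<cdot>\<^bsub>C\<^esub> f = g))"

definition regular_epi :: "('o, 'm) category \<Rightarrow> 'm \<Rightarrow> bool" where
  "regular_epi C f \<longleftrightarrow> (\<exists>u v. is_coequalizer C u v f)"

text \<open>\<open>is_pullback C f g p q\<close>: the projections \<open>p\<close>, \<open>q\<close> (with common domain the
  pullback object) go to the domains of \<open>f\<close> and \<open>g\<close>, respectively.\<close>

definition is_pullback :: "('o, 'm) category \<Rightarrow> 'm \<Rightarrow> 'm \<Rightarrow> 'm \<Rightarrow> 'm \<Rightarrow> bool" where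
  "is_pullback C f g p q \<longleftrightarrow>
     f \<in> Mor C \<and> g \<in> Mor C \<and> p \<in> Mor C \<and> q \<in> Mor C \<and>
     Cod C f = Cod C g \<and> Dom C p = Dom C q \<and> Cod C p = Dom C f \<and> Cod C q = Dom C g \<and>
     f \<cdot>\<^bsub>C\<^esub> p = g \<cdot>\<^bsub>C\<^esub> q \<and>
     (\<forall>r \<in> Mor C. \<forall>s \<in> Mor C.
        Dom C r = Dom C s \<and> Cod C r = Dom C f \<and> Cod C s = Dom C g \<and>
        f \<cdot>\<^bsub>C\<^esub> r = g \<cdot>\<^bsub>C\<^esub> s \<longrightarrow>
        (\<exists>!w. w \<in> hom C (Dom C r) (Dom C p) \<and> p \<cdot>\<^bsub>C\<^esub> w = r \<and> q \<cdot>\<^bsub>C\<^esub> w = s))"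

text \<open>\<open>is_pushout C f g p q\<close>: the span is \<open>f\<close>, \<open>g\<close>; the coprojections \<open>p\<close>, \<open>q\<close> start at
  the codomains of \<open>f\<close> and \<open>g\<close>, respectively.\<close>

definition is_pushout :: "('o, 'm) category \<Rightarrow> 'm \<Rightarrow> 'm \<Rightarrow> 'm \<Rightarrow> 'm \<Rightarrow> bool" where
  "is_pushout C f g p q \<longleftrightarrow>
     f \<in> Mor C \<and> g \<in> Mor C \<and> p \<in> Mor C \<and> q \<in> Mor C \<and>
     Dom C f = Dom C g \<and> Cod C p = Cod C q \<and> Dom C p = Cod C f \<and> Dom C q = Cod C g \<and>
     p \<cdot>\<^bsub>C\<^esub> f = q \<cdot>\<^bsub>C\<^esub> g \<and>
     (\<forall>r \<in> Mor C. \<forall>s \<in> Mor C.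
        Cod C r = Cod C s \<and> Dom C r = Cod C f \<and> Dom C s = Cod C g \<and>
        r \<cdot>\<^bsub>C\<^esub> f = s \<cdot>\<^bsub>C\<^esub> g \<longrightarrow>
        (\<exists>!w. w \<in> hom C (Cod C p) (Cod C r) \<and> w \<cdot>\<^bsub>C\<^esub> p = r \<and> w \<cdot>\<^bsub>C\<^esub> q = s))"

definition full_subcategory ::
  "('o, 'm) category \<Rightarrow> 'o set \<Rightarrow> ('o, 'm) category" where
  "full_subcategory C S =
     C\<lparr>Ob := Ob C \<inter> S, Mor := {f \<in> Mor C. Dom C f \<in> S \<and> Cod C f \<in> S}\<rparr>"

definition full_replete_subcategory ::
  "('o, 'm) category \<Rightarrow> ('o, 'm) category \<Rightarrow> bool" where
  "full_replete_subcategory X Y \<longleftrightarrow>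
     category Y \<and> Ob X \<subseteq> Ob Y \<and> X = full_subcategory Y (Ob X) \<and>
     (\<forall>f. iso Y f \<and> Dom Y f \<in> Ob X \<longrightarrow> Cod Y f \<in> Ob X)"

section \<open>Barr exact categories\<close>

definition is_terminal :: "('o, 'm) category \<Rightarrow> 'o \<Rightarrow> bool" where
  "is_terminal C t \<longleftrightarrow> t \<in> Ob C \<and> (\<forall>a \<in> Ob C. \<exists>!f. f \<in> hom C a t)"

text \<open>Finite completeness is expressed by a terminal object and pullbacks.\<close>

locale finitely_complete_category = category C
  for C :: "('o, 'm) category" (structure) +
  assumes ex_terminal: "\<exists>t. is_terminal C t"
    and ex_pullback:
      "\<lbrakk>f \<in> Mor C; g \<in> Mor C; Cod C f = Cod C g\<rbrakk> \<Longrightarrow> \<exists>p q. is_pullback C f g p q"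

locale regular_category = finitely_complete_category C
  for C :: "('o, 'm) category" (structure) +
  assumes ex_coequalizer_kernel_pair:
      "is_pullback C f f p q \<Longrightarrow> \<exists>e. is_coequalizer C p q e"
    and regular_epi_pullback:
      "\<lbrakk>is_pullback C f g p q; regular_epi C f\<rbrakk> \<Longrightarrow> regular_epi C q"

text \<open>An internal equivalence relation: a jointly monic pair \<open>d, c : R \<rightarrow> X\<close> that is reflexive,
  symmetric and transitive. For transitivity \<open>p, q\<close> are the projections of the object
  of composable pairs \<open>R \<times>\<^sub>X R\<close>.\<close>

definition equivalence_relation :: "('o, 'm) category \<Rightarrow> 'm \<Rightarrow> 'm \<Rightarrow> bool" where
  "equivalence_relation C d c \<longleftrightarrow>
     d \<in> Mor C \<and> c \<in> Mor C \<and> Dom C d = Dom C c \<and> Cod C d = Cod C c \<and>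
     (\<forall>u \<in> Mor C. \<forall>v \<in> Mor C.
        Dom C u = Dom C v \<and> Cod C u = Dom C d \<and> Cod C v = Dom C d \<and>
        d \<cdot>\<^bsub>C\<^esub> u = d \<cdot>\<^bsub>C\<^esub> v \<and> c \<cdot>\<^bsub>C\<^esub> u = c \<cdot>\<^bsub>C\<^esub> v \<longrightarrow> u = v) \<and>
     (\<exists>r \<in> hom C (Cod C d) (Dom C d).
        d \<cdot>\<^bsub>C\<^esub> r = Idn C (Cod C d) \<and> c \<cdot>\<^bsub>C\<^esub> r = Idn C (Cod C d)) \<and>
     (\<exists>s \<in> hom C (Dom C d) (Dom C d). d \<cdot>\<^bsub>C\<^esub> s = c \<and> c \<cdot>\<^bsub>C\<^esub> s = d) \<and>
     (\<forall>p q. is_pullback C c d p q \<longrightarrow>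
        (\<exists>t \<in> hom C (Dom C p) (Dom C d).
           d \<cdot>\<^bsub>C\<^esub> t = d \<cdot>\<^bsub>C\<^esub> p \<and> c \<cdot>\<^bsub>C\<^esub> t = c \<cdot>\<^bsub>C\<^esub> q))"

locale barr_exact_category = regular_category C
  for C :: "('o, 'm) category" (structure) +
  assumes equivalence_relation_effective:
    "equivalence_relation C d c \<Longrightarrow> \<exists>f. is_pullback C f f d c"

section \<open>Functors, adjunctions, monadicity\<close>

record ('o1, 'm1, 'o2, 'm2) func =
  Fob :: "'o1 \<Rightarrow> 'o2"
  Fmor :: "'m1 \<Rightarrow> 'm2"

locale is_functor = A: category A + B: category B
  for A :: "('o1, 'm1) category" and B :: "('o2, 'm2) category" +
  fixes F :: "('o1, 'm1, 'o2, 'm2) func"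
  assumes Fob_closed: "a \<in> Ob A \<Longrightarrow> Fob F a \<in> Ob B"
    and Fmor_hom: "f \<in> hom A a b \<Longrightarrow> Fmor F f \<in> hom B (Fob F a) (Fob F b)"
    and Fmor_Idn: "a \<in> Ob A \<Longrightarrow> Fmor F (Idn A a) = Idn B (Fob F a)"
    and Fmor_Comp:
      "\<lbrakk>f \<in> hom A a b; g \<in> hom A b c\<rbrakk> \<Longrightarrow> Fmor F (g \<cdot>\<^bsub>A\<^esub> f) = Fmor F g \<cdot>\<^bsub>B\<^esub> Fmor F f"

definition func_id :: "('o, 'm, 'o, 'm) func" where
  "func_id = \<lparr>Fob = (\<lambda>a. a), Fmor = (\<lambda>f. f)\<rparr>"

definition func_comp ::
  "('o2, 'm2, 'o3, 'm3) func \<Rightarrow> ('o1, 'm1, 'o2, 'm2) func \<Rightarrow> ('o1, 'm1, 'o3, 'm3) func" where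
  "func_comp G F = \<lparr>Fob = Fob G \<circ> Fob F, Fmor = Fmor G \<circ> Fmor F\<rparr>"

locale natural_transformation = F: is_functor A B F + G: is_functor A B G
  for A :: "('o1, 'm1) category" and B :: "('o2, 'm2) category"
    and F :: "('o1, 'm1, 'o2, 'm2) func" and G :: "('o1, 'm1, 'o2, 'm2) func" +
  fixes \<tau> :: "'o1 \<Rightarrow> 'm2"
  assumes component_hom: "a \<in> Ob A \<Longrightarrow> \<tau> a \<in> hom B (Fob F a) (Fob G a)"
    and naturality:
      "f \<in> hom A a b \<Longrightarrow> \<tau> b \<cdot>\<^bsub>B\<^esub> Fmor F f = Fmor G f \<cdot>\<^bsub>B\<^esub> \<tau> a"

definition equivalence_functor ::
  "('o1, 'm1) category \<Rightarrow> ('o2, 'm2) category \<Rightarrow> ('o1, 'm1, 'o2, 'm2) func \<Rightarrow> bool" where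
  "equivalence_functor A B F \<longleftrightarrow>
     is_functor A B F \<and>
     (\<exists>G \<sigma> \<tau>. is_functor B A G \<and>
        natural_transformation A A func_id (func_comp G F) \<sigma> \<and> (\<forall>a \<in> Ob A. iso A (\<sigma> a)) \<and>
        natural_transformation B B (func_comp F G) func_id \<tau> \<and> (\<forall>b \<in> Ob B. iso B (\<tau> b)))"

text \<open>\<open>adjunction A B L R \<eta> \<epsilon>\<close>: the functor \<open>L : A \<rightarrow> B\<close> is left adjoint to \<open>R : B \<rightarrow> A\<close>.\<close>

locale adjunction =
  unit: natural_transformation A A func_id "func_comp R L" \<eta> +
  counit: natural_transformation B B "func_comp L R" func_id \<epsilon> +
  L: is_functor A B L + R: is_functor B A R
  for A :: "('o1, 'm1) category" and B :: "('o2, 'm2) category"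
    and L :: "('o1, 'm1, 'o2, 'm2) func" and R :: "('o2, 'm2, 'o1, 'm1) func"
    and \<eta> :: "'o1 \<Rightarrow> 'm1" and \<epsilon> :: "'o2 \<Rightarrow> 'm2" +
  assumes triangle_L:
      "a \<in> Ob A \<Longrightarrow> \<epsilon> (Fob L a) \<cdot>\<^bsub>B\<^esub> Fmor L (\<eta> a) = Idn B (Fob L a)"
    and triangle_R:
      "b \<in> Ob B \<Longrightarrow> Fmor R (\<epsilon> b) \<cdot>\<^bsub>A\<^esub> \<eta> (Fob R b) = Idn A (Fob R b)"

definition algebras ::
  "('o, 'm) category \<Rightarrow> ('o, 'm, 'o, 'm) func \<Rightarrow> ('o \<Rightarrow> 'm) \<Rightarrow> ('o \<Rightarrow> 'm) \<Rightarrow> ('o \<times> 'm) set" where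
  "algebras X T \<eta> \<mu> =
     {(x, h). x \<in> Ob X \<and> h \<in> hom X (Fob T x) x \<and>
        h \<cdot>\<^bsub>X\<^esub> \<eta> x = Idn X x \<and> h \<cdot>\<^bsub>X\<^esub> Fmor T h = h \<cdot>\<^bsub>X\<^esub> \<mu> x}"

definition eilenberg_moore ::
  "('o, 'm) category \<Rightarrow> ('o, 'm, 'o, 'm) func \<Rightarrow> ('o \<Rightarrow> 'm) \<Rightarrow> ('o \<Rightarrow> 'm) \<Rightarrow>
   ('o \<times> 'm, ('o \<times> 'm) \<times> 'm \<times> ('o \<times> 'm)) category" where
  "eilenberg_moore X T \<eta> \<mu> =
     \<lparr>Ob = algebras X T \<eta> \<mu>,
      Mor = {((x, h), k, (y, l)) | x h k y l.
               (x, h) \<in> algebras X T \<eta> \<mu> \<and> (y, l) \<in> algebras X T \<eta> \<mu> \<and>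
               k \<in> hom X x y \<and> k \<cdot>\<^bsub>X\<^esub> h = l \<cdot>\<^bsub>X\<^esub> Fmor T k},
      Dom = (\<lambda>(a, k, b). a),
      Cod = (\<lambda>(a, k, b). b),
      Idn = (\<lambda>(x, h). ((x, h), Idn X x, (x, h))),
      Comp = (\<lambda>(b, l, c) (a, k, b'). (a, l \<cdot>\<^bsub>X\<^esub> k, c))\<rparr>"

definition comparison_functor ::
  "('o1, 'm1) category \<Rightarrow> ('o1, 'm1, 'o2, 'm2) func \<Rightarrow> ('o1 \<Rightarrow> 'm1) \<Rightarrow>
   ('o1, 'm1, 'o2 \<times> 'm2, ('o2 \<times> 'm2) \<times> 'm2 \<times> ('o2 \<times> 'm2)) func" where
  "comparison_functor A U \<epsilon> =
     (let K = (\<lambda>a. (Fob U a, Fmor U (\<epsilon> a)))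
      in \<lparr>Fob = K, Fmor = (\<lambda>f. (K (Dom A f), Fmor U f, K (Cod A f)))\<rparr>)"

definition monadic ::
  "('o1, 'm1) category \<Rightarrow> ('o2, 'm2) category \<Rightarrow> ('o1, 'm1, 'o2, 'm2) func \<Rightarrow> bool" where
  "monadic A X U \<longleftrightarrow>
     (\<exists>L \<eta> \<epsilon>. adjunction X A L U \<eta> \<epsilon> \<and>
        equivalence_functor A
          (eilenberg_moore X (func_comp U L) \<eta> (\<lambda>x. Fmor U (\<epsilon> (Fob L x))))
          (comparison_functor A U \<epsilon>))"

section \<open>Effective descent\<close>

definition slice :: "('o, 'm) category \<Rightarrow> 'o \<Rightarrow> ('m, 'm \<times> 'm \<times> 'm) category" where
  "slice Y b =
     \<lparr>Ob = {f \<in> Mor Y. Cod Y f = b},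
      Mor = {(f, h, g) | f h g. f \<in> Mor Y \<and> g \<in> Mor Y \<and> Cod Y f = b \<and> Cod Y g = b \<and>
               h \<in> hom Y (Dom Y f) (Dom Y g) \<and> g \<cdot>\<^bsub>Y\<^esub> h = f},
      Dom = (\<lambda>(f, h, g). f),
      Cod = (\<lambda>(f, h, g). g),
      Idn = (\<lambda>f. (f, Idn Y (Dom Y f), f)),
      Comp = (\<lambda>(g, k, l) (f, h, g'). (f, k \<cdot>\<^bsub>Y\<^esub> h, l))\<rparr>"

definition ext_slice ::
  "('o, 'm) category \<Rightarrow> 'm set \<Rightarrow> 'o \<Rightarrow> ('m, 'm \<times> 'm \<times> 'm) category" where
  "ext_slice Y E b = full_subcategory (slice Y b) E"

text \<open>A choice of pullbacks; a different choice gives a naturally isomorphic pullback functor.\<close>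

definition chosen_pullback :: "('o, 'm) category \<Rightarrow> 'm \<Rightarrow> 'm \<Rightarrow> 'm \<times> 'm" where
  "chosen_pullback Y e f = (SOME (p, q). is_pullback Y e f p q)"

definition pullback_functor ::
  "('o, 'm) category \<Rightarrow> 'm \<Rightarrow> ('m, 'm \<times> 'm \<times> 'm, 'm, 'm \<times> 'm \<times> 'm) func" where
  "pullback_functor Y e =
     (let P = (\<lambda>f. fst (chosen_pullback Y e f)); Q = (\<lambda>f. snd (chosen_pullback Y e f))
      in \<lparr>Fob = P,
          Fmor = (\<lambda>(f, h, g).
            (P f,
             THE k. k \<in> hom Y (Dom Y (P f)) (Dom Y (P g)) \<and>
                    P g \<cdot>\<^bsub>Y\<^esub> k = P f \<and> Q g \<cdot>\<^bsub>Y\<^esub> k = h \<cdot>\<^bsub>Y\<^esub> Q f,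
             P g))\<rparr>)"

definition effective_descent :: "('o, 'm) category \<Rightarrow> 'm set \<Rightarrow> 'm \<Rightarrow> bool" where
  "effective_descent Y E e \<longleftrightarrow>
     monadic (ext_slice Y E (Cod Y e)) (ext_slice Y E (Dom Y e)) (pullback_functor Y e)"

section \<open>Double extensions\<close>

text \<open>The square has vertical sides \<open>fA\<close>, \<open>fB\<close> and horizontal sides \<open>t\<close> (top), \<open>b\<close> (bottom);
  \<open>p\<close>, \<open>q\<close> are the projections of the pullback and \<open>c\<close> is the comparison map.\<close>

definition double_extension ::
  "('o, 'm) category \<Rightarrow> 'm set \<Rightarrow> 'm \<Rightarrow> 'm \<Rightarrow> 'm \<Rightarrow> 'm \<Rightarrow> bool" where
  "double_extension Y E fA fB t b \<longleftrightarrow>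
     fA \<in> Mor Y \<and> fB \<in> Mor Y \<and> t \<in> hom Y (Dom Y fA) (Dom Y fB) \<and> b \<in> hom Y (Cod Y fA) (Cod Y fB) \<and>
     fB \<cdot>\<^bsub>Y\<^esub> t = b \<cdot>\<^bsub>Y\<^esub> fA \<and>
     fA \<in> E \<and> fB \<in> E \<and> t \<in> E \<and> b \<in> E \<and>
     (\<exists>p q c. is_pullback Y b fB p q \<and> p \<in> E \<and> q \<in> E \<and>
        c \<in> hom Y (Dom Y fA) (Dom Y p) \<and> p \<cdot>\<^bsub>Y\<^esub> c = fA \<and> q \<cdot>\<^bsub>Y\<^esub> c = t \<and> c \<in> E)"

section \<open>Reflective subcategories, Birkhoff conditions, Galois structures\<close>

text \<open>As \<open>X\<close> is a full subcategory of \<open>Y\<close>, the inclusion \<open>I : X \<rightarrow> Y\<close> acts as the identity on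
  objects and morphisms. It is given by \<open>func_id\<close> and otherwise suppressed.\<close>

locale ext_reflective =
  adjunction Y X L func_id \<eta> \<epsilon>
  for Y :: "('o, 'm) category" and X :: "('o, 'm) category" and L :: "('o, 'm, 'o, 'm) func"
    and \<eta> :: "'o \<Rightarrow> 'm" and \<epsilon> :: "'o \<Rightarrow> 'm" and E :: "'m set" +
  assumes full_replete: "full_replete_subcategory X Y"
    and unit_ext: "y \<in> Ob Y \<Longrightarrow> \<eta> y \<in> E"

definition birkhoff ::
  "('o, 'm) category \<Rightarrow> ('o, 'm, 'o, 'm) func \<Rightarrow> ('o \<Rightarrow> 'm) \<Rightarrow> 'm set \<Rightarrow> bool" where
  "birkhoff Y L \<eta> E \<longleftrightarrow>
     (\<forall>f \<in> E. is_pushout Y f (\<eta> (Dom Y f)) (\<eta> (Cod Y f)) (Fmor L f))"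

definition strongly_birkhoff ::
  "('o, 'm) category \<Rightarrow> ('o, 'm, 'o, 'm) func \<Rightarrow> ('o \<Rightarrow> 'm) \<Rightarrow> 'm set \<Rightarrow> bool" where
  "strongly_birkhoff Y L \<eta> E \<longleftrightarrow>
     (\<forall>f \<in> E. double_extension Y E f (Fmor L f) (\<eta> (Dom Y f)) (\<eta> (Cod Y f)))"

definition closed_under_quotients ::
  "('o, 'm) category \<Rightarrow> ('o, 'm) category \<Rightarrow> 'm set \<Rightarrow> bool" where
  "closed_under_quotients Y X E \<longleftrightarrow> (\<forall>f \<in> E. Dom Y f \<in> Ob X \<longrightarrow> Cod Y f \<in> Ob X)"

locale galois_structure = ext_reflective Y X L \<eta> \<epsilon> E
  for Y :: "('o, 'm) category" and X :: "('o, 'm) category" and L :: "('o, 'm, 'o, 'm) func"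
    and \<eta> :: "'o \<Rightarrow> 'm" and \<epsilon> :: "'o \<Rightarrow> 'm" and E :: "'m set" +
  assumes ext_regular_epi: "f \<in> E \<Longrightarrow> regular_epi Y f"
    and iso_ext: "iso Y f \<Longrightarrow> f \<in> E"
    and Comp_ext: "\<lbrakk>f \<in> E; g \<in> E; Cod Y f = Dom Y g\<rbrakk> \<Longrightarrow> g \<cdot>\<^bsub>Y\<^esub> f \<in> E"
    and L_ext: "f \<in> E \<Longrightarrow> Fmor L f \<in> E"
    and ex_pullback_ext:
      "\<lbrakk>e \<in> E; g \<in> Mor Y; Cod Y e = Cod Y g\<rbrakk> \<Longrightarrow> \<exists>p q. is_pullback Y e g p q"
    and pullback_ext: "\<lbrakk>is_pullback Y e g p q; e \<in> E\<rbrakk> \<Longrightarrow> q \<in> E"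
    and ext_effective_descent: "e \<in> E \<Longrightarrow> effective_descent Y E e"

definition trivial_covering ::
  "('o, 'm) category \<Rightarrow> ('o, 'm, 'o, 'm) func \<Rightarrow> ('o \<Rightarrow> 'm) \<Rightarrow> 'm set \<Rightarrow> 'm \<Rightarrow> bool" where
  "trivial_covering Y L \<eta> E f \<longleftrightarrow>
     f \<in> E \<and> is_pullback Y (\<eta> (Cod Y f)) (Fmor L f) f (\<eta> (Dom Y f))"

definition covering ::
  "('o, 'm) category \<Rightarrow> ('o, 'm, 'o, 'm) func \<Rightarrow> ('o \<Rightarrow> 'm) \<Rightarrow> 'm set \<Rightarrow> 'm \<Rightarrow> bool" where
  "covering Y L \<eta> E c \<longleftrightarrow>
     c \<in> E \<and> (\<exists>e p q. e \<in> E \<and> is_pullback Y e c p q \<and> trivial_covering Y L \<eta> E p)"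

section \<open>Higher extensions\<close>

text \<open>The category \<open>Arr Y\<close> has the morphisms of \<open>Y\<close> as its objects and the commutative squares
  of \<open>Y\<close> as its morphisms. As \<open>Arr\<close> is to be iterated a variable number of times, its objects and
  morphisms must not change type: \<open>cell\<close> contains the objects and the morphisms of the base
  category together with formal squares of cells.
  A square \<open>Square fA fB t b\<close> is a morphism \<open>(t, b) : fA \<rightarrow> fB\<close>.\<close>

datatype ('o, 'm) cell =
    Vertex (vertex: 'o)
  | Edge (edge: 'm)
  | Square (sq_dom: "('o, 'm) cell") (sq_cod: "('o, 'm) cell")
      (sq_top: "('o, 'm) cell") (sq_bot: "('o, 'm) cell")

type_synonym ('o, 'm) cell_category = "(('o, 'm) cell, ('o, 'm) cell) category"

text \<open>The copy of \<open>C\<close> inside \<open>cell\<close>.\<close>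

definition base_category :: "('o, 'm) category \<Rightarrow> ('o, 'm) cell_category" where
  "base_category C =
     \<lparr>Ob = Vertex ` Ob C,
      Mor = Edge ` Mor C,
      Dom = (\<lambda>f. Vertex (Dom C (edge f))),
      Cod = (\<lambda>f. Vertex (Cod C (edge f))),
      Idn = (\<lambda>a. Edge (Idn C (vertex a))),
      Comp = (\<lambda>g f. Edge (edge g \<cdot>\<^bsub>C\<^esub> edge f))\<rparr>"

definition Arr :: "('o, 'm) cell_category \<Rightarrow> ('o, 'm) cell_category" where
  "Arr Y =
     \<lparr>Ob = Mor Y,
      Mor = {Square fA fB t b | fA fB t b.
               fA \<in> Mor Y \<and> fB \<in> Mor Y \<and>
               t \<in> hom Y (Dom Y fA) (Dom Y fB) \<and> b \<in> hom Y (Cod Y fA) (Cod Y fB) \<and>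
               fB \<cdot>\<^bsub>Y\<^esub> t = b \<cdot>\<^bsub>Y\<^esub> fA},
      Dom = sq_dom,
      Cod = sq_cod,
      Idn = (\<lambda>f. Square f f (Idn Y (Dom Y f)) (Idn Y (Cod Y f))),
      Comp = (\<lambda>\<beta> \<alpha>. Square (sq_dom \<alpha>) (sq_cod \<beta>)
                 (sq_top \<beta> \<cdot>\<^bsub>Y\<^esub> sq_top \<alpha>) (sq_bot \<beta> \<cdot>\<^bsub>Y\<^esub> sq_bot \<alpha>))\<rparr>"

definition Ext :: "('o, 'm) cell_category \<Rightarrow> ('o, 'm) cell set \<Rightarrow> ('o, 'm) cell_category" where
  "Ext Y E = full_subcategory (Arr Y) E"

definition double_extensions ::
  "('o, 'm) cell_category \<Rightarrow> ('o, 'm) cell set \<Rightarrow> ('o, 'm) cell set" where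
  "double_extensions Y E =
     {\<alpha> \<in> Mor (Ext Y E). double_extension Y E (sq_dom \<alpha>) (sq_cod \<alpha>) (sq_top \<alpha>) (sq_bot \<alpha>)}"

text \<open>\<open>ext_tower C m\<close> is the pair \<open>(C\<^sub>m, E\<^sub>m\<^sub>+\<^sub>1)\<close> of the category of \<open>m\<close>-fold extensions and its
  class of extensions, the \<open>(m+1)\<close>-fold extensions.\<close>

primrec ext_tower ::
  "('o, 'm) category \<Rightarrow> nat \<Rightarrow> ('o, 'm) cell_category \<times> ('o, 'm) cell set" where
  "ext_tower C 0 = (base_category C, {f. regular_epi (base_category C) f})"
| "ext_tower C (Suc m) =
     (let (Y, E) = ext_tower C m in (Ext Y E, double_extensions Y E))"

definition ext_category :: "('o, 'm) category \<Rightarrow> nat \<Rightarrow> ('o, 'm) cell_category" where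
  "ext_category C m = fst (ext_tower C m)"

text \<open>The class \<open>E\<^sub>m\<close> of \<open>m\<close>-fold extensions, meaningful for \<open>m \<ge> 1\<close> only.\<close>

definition ext_class :: "('o, 'm) category \<Rightarrow> nat \<Rightarrow> ('o, 'm) cell set" where
  "ext_class C m = snd (ext_tower C (m - 1))"

definition Cov ::
  "('o, 'm) cell_category \<Rightarrow>
   (('o, 'm) cell, ('o, 'm) cell, ('o, 'm) cell, ('o, 'm) cell) func \<Rightarrow>
   (('o, 'm) cell \<Rightarrow> ('o, 'm) cell) \<Rightarrow> ('o, 'm) cell set \<Rightarrow> ('o, 'm) cell_category" where
  "Cov Y L \<eta> E = full_subcategory (Ext Y E) {c. covering Y L \<eta> E c}"

end

theory Submission
  imports Defs
begin

text \<open>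
  Let \<open>f : A \<rightarrow> B\<close> be an extension between higher extensions.

  If the reflection square of \<open>f\<close> is a pushout and \<open>A\<close> lies in the subcategory, then
  \<open>\<eta>\<^sub>A\<close> is invertible, so its pushout \<open>\<eta>\<^sub>B\<close> is invertible and \<open>B\<close> lies in the
  subcategory. This direction (\<open>birkhoff_imp_closed_under_quotients\<close>) holds for every
  reflective subcategory with units in a class of epimorphisms.

  For the converse, let \<open>r\<close> be a morphism on \<open>B\<close> and \<open>s\<close> a morphism on \<open>LA\<close> with \<open>r \<cdot> f
  = s \<cdot> \<eta>\<^sub>A\<close>. It suffices to factor \<open>r\<close> as \<open>i \<cdot> q\<close> such that the codomain of \<open>q\<close>
  receives an extension from \<open>LA\<close>: closure under quotients then puts this codomain into
  the subcategory, \<open>q\<close> factors through \<open>\<eta>\<^sub>B\<close>, and hence so does \<open>r\<close>. In a regular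
  category one takes the image of \<open>r\<close>. In a category of higher extensions the vertexwise
  image of \<open>r\<close> need not be a higher extension. The remedy is that the units of
  reflections onto coverings are very special: seen as a morphism of cubes over the base
  category, such a unit is invertible at all vertices except the initial one. Call these
  the corner morphisms (\<open>corners\<close>). If \<open>\<eta>\<^sub>A\<close> is a corner morphism, one can pull the
  codomain of \<open>r\<close> back until \<open>r\<close> itself is the identity except at the initial vertex,
  and then only a single image, at that vertex and in the base category, has to be
  taken.

  The argument therefore rests on four properties of corner morphisms and extensions
  (locale \<open>corner_class\<close>), which hold for all morphisms of a regular category
  (\<open>corner_class_all\<close>) and pass from a category with extensions to its category of
  extensions (\<open>corner_class_squares\<close>).

  The units are corner morphisms by induction on the dimension (\<open>unit_corner_squares\<close>).
  Each extension \<open>f\<close> factors as \<open>p \<cdot> c\<close> where \<open>c\<close> is a corner morphism and the extension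
  \<open>p\<close> is, seen as a cube, the limit cone over its vertices other than the initial one;
  abstractly, \<open>p\<close> has the right lifting property against corner morphisms. If the units
  one dimension lower are corner morphisms, the strong Birkhoff condition makes \<open>p\<close> a
  trivial covering (\<open>right_lifting_imp_trivial_covering\<close>). Hence \<open>f \<rightarrow> p\<close>, given by \<open>c\<close>
  and an identity, factors through the unit at \<open>f\<close>, and as the components of that unit
  are extensions, the unit is itself a corner morphism.
\<close>

section \<open>Morphisms, isomorphisms and pullbacks\<close>

context category
begin

lemma Mor_hom: "f \<in> Mor C \<Longrightarrow> f \<in> hom C (Dom C f) (Cod C f)"
  by (simp add: hom_def)

lemma Comp_props:
  assumes "f \<in> Mor C" "g \<in> Mor C" "Cod C f = Dom C g"
  shows "g \<cdot> f \<in> Mor C \<and> Dom C (g \<cdot> f) = Dom C f \<and> Cod C (g \<cdot> f) = Cod C g"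
  using Comp_hom[of f "Dom C f" "Dom C g" g "Cod C g"] assms by (simp add: hom_def)

lemma Comp_Mor [simp]: "\<lbrakk>f \<in> Mor C; g \<in> Mor C; Cod C f = Dom C g\<rbrakk> \<Longrightarrow> g \<cdot> f \<in> Mor C"
  and Dom_Comp [simp]: "\<lbrakk>f \<in> Mor C; g \<in> Mor C; Cod C f = Dom C g\<rbrakk> \<Longrightarrow> Dom C (g \<cdot> f) = Dom C f"
  and Cod_Comp [simp]: "\<lbrakk>f \<in> Mor C; g \<in> Mor C; Cod C f = Dom C g\<rbrakk> \<Longrightarrow> Cod C (g \<cdot> f) = Cod C g"
  using Comp_props by blast+

lemma assoc:
  "\<lbrakk>f \<in> Mor C; g \<in> Mor C; h \<in> Mor C; Cod C f = Dom C g; Cod C g = Dom C h\<rbrakk>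
    \<Longrightarrow> (h \<cdot> g) \<cdot> f = h \<cdot> (g \<cdot> f)"
  using Comp_assoc[of f "Dom C f" "Dom C g" g "Dom C h" h "Cod C h"] by (simp add: hom_def)

lemma absorb:
  "\<lbrakk>h \<cdot> g = k; f \<in> Mor C; g \<in> Mor C; h \<in> Mor C; Cod C f = Dom C g; Cod C g = Dom C h\<rbrakk>
    \<Longrightarrow> h \<cdot> (g \<cdot> f) = k \<cdot> f"
  by (simp flip: assoc)

lemma Idn_props [simp]:
  assumes "a \<in> Ob C"
  shows "Idn C a \<in> Mor C" "Dom C (Idn C a) = a" "Cod C (Idn C a) = a"
  using Idn_hom[OF assms] by (simp_all add: hom_def)

lemma Comp_Idn_Mor [simp]: "\<lbrakk>f \<in> Mor C; Dom C f = a\<rbrakk> \<Longrightarrow> f \<cdot> Idn C a = f"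
  and Idn_Comp_Mor [simp]: "\<lbrakk>f \<in> Mor C; Cod C f = b\<rbrakk> \<Longrightarrow> Idn C b \<cdot> f = f"
  using Comp_Idn Idn_Comp Mor_hom by blast+

declare Dom_closed [simp] Cod_closed [simp]

lemma isoE:
  assumes "iso C f"
  obtains g where "f \<in> Mor C" "g \<in> Mor C" "Dom C g = Cod C f" "Cod C g = Dom C f"
    "g \<cdot> f = Idn C (Dom C f)" "f \<cdot> g = Idn C (Cod C f)"
  using assms unfolding iso_def hom_def by blast

lemma isoI:
  assumes "f \<in> Mor C" "g \<in> Mor C" "Dom C g = Cod C f" "Cod C g = Dom C f"
    "g \<cdot> f = Idn C (Dom C f)" "f \<cdot> g = Idn C (Cod C f)"
  shows "iso C f"
  using assms unfolding iso_def hom_def by blast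

lemma iso_Idn: "a \<in> Ob C \<Longrightarrow> iso C (Idn C a)"
  by (rule isoI[where g = "Idn C a"]) simp_all

end

definition epi :: "('o, 'm) category \<Rightarrow> 'm \<Rightarrow> bool" where
  "epi Y f \<longleftrightarrow> f \<in> Mor Y \<and>
     (\<forall>g \<in> Mor Y. \<forall>h \<in> Mor Y. Dom Y g = Cod Y f \<and> Dom Y h = Cod Y f \<and>
        g \<cdot>\<^bsub>Y\<^esub> f = h \<cdot>\<^bsub>Y\<^esub> f \<longrightarrow> g = h)"

lemma epiD:
  "\<lbrakk>epi Y f; g \<cdot>\<^bsub>Y\<^esub> f = h \<cdot>\<^bsub>Y\<^esub> f; g \<in> Mor Y; h \<in> Mor Y; Dom Y g = Cod Y f; Dom Y h = Cod Y f\<rbrakk>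
    \<Longrightarrow> g = h"
  unfolding epi_def by blast

lemma is_pullbackD:
  assumes "is_pullback Y f g p q"
  shows "f \<in> Mor Y" "g \<in> Mor Y" "p \<in> Mor Y" "q \<in> Mor Y" "Cod Y f = Cod Y g" "Dom Y q = Dom Y p"
    "Cod Y p = Dom Y f" "Cod Y q = Dom Y g" "f \<cdot>\<^bsub>Y\<^esub> p = g \<cdot>\<^bsub>Y\<^esub> q"
  using assms by (simp_all add: is_pullback_def)

lemma pullback_lift:
  assumes "is_pullback Y f g p q" "f \<cdot>\<^bsub>Y\<^esub> r = g \<cdot>\<^bsub>Y\<^esub> s"
    "r \<in> Mor Y" "s \<in> Mor Y" "Dom Y r = Dom Y s" "Cod Y r = Dom Y f" "Cod Y s = Dom Y g"
  obtains w where "w \<in> Mor Y" "Dom Y w = Dom Y r" "Cod Y w = Dom Y p"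
    "p \<cdot>\<^bsub>Y\<^esub> w = r" "q \<cdot>\<^bsub>Y\<^esub> w = s"
proof -
  have "\<exists>!w. w \<in> hom Y (Dom Y r) (Dom Y p) \<and> p \<cdot>\<^bsub>Y\<^esub> w = r \<and> q \<cdot>\<^bsub>Y\<^esub> w = s"
    using assms unfolding is_pullback_def by blast
  then show thesis
    using that unfolding hom_def by blast
qed

context category
begin

lemma pullback_joint_mono:
  assumes "is_pullback C f g p q" "p \<cdot> v = p \<cdot> w" "q \<cdot> v = q \<cdot> w"
    "v \<in> Mor C" "w \<in> Mor C" "Dom C v = Dom C w" "Cod C v = Dom C p" "Cod C w = Dom C p"
  shows "v = w"
proof -
  note pb = is_pullbackD[OF assms(1)]
  have "f \<cdot> (p \<cdot> w) = g \<cdot> (q \<cdot> w)"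
    using pb assms by (metis assoc)
  then have "\<exists>!x. x \<in> hom C (Dom C (p \<cdot> w)) (Dom C p) \<and> p \<cdot> x = p \<cdot> w \<and> q \<cdot> x = q \<cdot> w"
    using assms(1)[unfolded is_pullback_def, THEN conjunct2, THEN conjunct2, THEN conjunct2,
        THEN conjunct2, THEN conjunct2, THEN conjunct2, THEN conjunct2, THEN conjunct2,
        THEN conjunct2, THEN bspec, of "p \<cdot> w", THEN bspec, of "q \<cdot> w"] pb assms(4-8)
    by simp
  then show ?thesis
    using assms pb by (auto simp: hom_def)
qed

lemma is_pullbackI:
  assumes "f \<in> Mor C" "g \<in> Mor C" "p \<in> Mor C" "q \<in> Mor C" "Cod C f = Cod C g"
    "Dom C p = Dom C q" "Cod C p = Dom C f" "Cod C q = Dom C g" "f \<cdot> p = g \<cdot> q"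
    and lift: "\<And>r s. \<lbrakk>r \<in> Mor C; s \<in> Mor C; Dom C r = Dom C s; Cod C r = Dom C f;
        Cod C s = Dom C g; f \<cdot> r = g \<cdot> s\<rbrakk>
      \<Longrightarrow> \<exists>w \<in> Mor C. Dom C w = Dom C r \<and> Cod C w = Dom C p \<and> p \<cdot> w = r \<and> q \<cdot> w = s"
    and mono: "\<And>v w. \<lbrakk>v \<in> Mor C; w \<in> Mor C; Dom C v = Dom C w; Cod C v = Dom C p;
        Cod C w = Dom C p; p \<cdot> v = p \<cdot> w; q \<cdot> v = q \<cdot> w\<rbrakk> \<Longrightarrow> v = w"
  shows "is_pullback C f g p q"
  unfolding is_pullback_def
proof (intro conjI ballI impI)
  fix r s
  assume rs: "r \<in> Mor C" "s \<in> Mor C"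
    "Dom C r = Dom C s \<and> Cod C r = Dom C f \<and> Cod C s = Dom C g \<and> f \<cdot> r = g \<cdot> s"
  then obtain w where w: "w \<in> Mor C" "Dom C w = Dom C r" "Cod C w = Dom C p" "p \<cdot> w = r" "q \<cdot> w = s"
    using lift by blast
  show "\<exists>!w. w \<in> hom C (Dom C r) (Dom C p) \<and> p \<cdot> w = r \<and> q \<cdot> w = s"
  proof (rule ex1I[of _ w])
    show "w \<in> hom C (Dom C r) (Dom C p) \<and> p \<cdot> w = r \<and> q \<cdot> w = s"
      using w by (simp add: hom_def)
  next
    fix v assume "v \<in> hom C (Dom C r) (Dom C p) \<and> p \<cdot> v = r \<and> q \<cdot> v = s"
    then show "v = w"
      using mono[of v w] w by (simp add: hom_def)
  qed
qed (use assms(1-9) in simp_all)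

lemma pullback_sym:
  assumes "is_pullback C f g p q"
  shows "is_pullback C g f q p"
proof (rule is_pullbackI)
  note pb = is_pullbackD[OF assms]
  show "\<exists>w \<in> Mor C. Dom C w = Dom C r \<and> Cod C w = Dom C q \<and> q \<cdot> w = r \<and> p \<cdot> w = s"
    if "r \<in> Mor C" "s \<in> Mor C" "Dom C r = Dom C s" "Cod C r = Dom C g" "Cod C s = Dom C f"
      "g \<cdot> r = f \<cdot> s" for r s
    by (rule pullback_lift[OF assms, of s r]) (use that pb in auto)
  show "v = w"
    if "v \<in> Mor C" "w \<in> Mor C" "Dom C v = Dom C w" "Cod C v = Dom C q" "Cod C w = Dom C q"
      "q \<cdot> v = q \<cdot> w" "p \<cdot> v = p \<cdot> w" for v w
    using pullback_joint_mono[OF assms] that pb by simp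
qed (use is_pullbackD[OF assms] in simp_all)

lemma pullback_along_iso:
  assumes "iso C b" "g \<in> Mor C" "Cod C g = Cod C b"
    and k: "k \<in> Mor C" "Dom C k = Cod C b" "Cod C k = Dom C b"
      "k \<cdot> b = Idn C (Dom C b)" "b \<cdot> k = Idn C (Cod C b)"
  shows "is_pullback C b g (k \<cdot> g) (Idn C (Dom C g))"
proof (rule is_pullbackI)
  have b: "b \<in> Mor C"
    using assms(1) by (simp add: iso_def)
  show "b \<cdot> (k \<cdot> g) = g \<cdot> Idn C (Dom C g)"
    using b assms by (simp flip: assoc)
  show "\<exists>w \<in> Mor C. Dom C w = Dom C r \<and> Cod C w = Dom C (k \<cdot> g) \<and> (k \<cdot> g) \<cdot> w = r \<and>
      Idn C (Dom C g) \<cdot> w = s"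
    if rs: "r \<in> Mor C" "s \<in> Mor C" "Dom C r = Dom C s" "Cod C r = Dom C b" "Cod C s = Dom C g"
      "b \<cdot> r = g \<cdot> s" for r s
  proof (rule bexI[of _ s])
    have "(k \<cdot> g) \<cdot> s = k \<cdot> (b \<cdot> r)"
      using rs b assms by (simp add: assoc)
    also have "\<dots> = r"
      using absorb[OF k(4), of r] rs b assms by simp
    finally show "Dom C s = Dom C r \<and> Cod C s = Dom C (k \<cdot> g) \<and> (k \<cdot> g) \<cdot> s = r \<and>
        Idn C (Dom C g) \<cdot> s = s"
      using rs b assms by simp
  qed fact
qed (use assms in \<open>auto simp: iso_def\<close>)

lemma pullback_precompose_iso:
  assumes "is_pullback C f g p q" "iso C c" "Cod C c = Dom C p"
  shows "is_pullback C f g (p \<cdot> c) (q \<cdot> c)"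
proof -
  note pb = is_pullbackD[OF assms(1)]
  from assms(2) obtain d where d: "c \<in> Mor C" "d \<in> Mor C" "Dom C d = Cod C c" "Cod C d = Dom C c"
    "d \<cdot> c = Idn C (Dom C c)" "c \<cdot> d = Idn C (Cod C c)"
    by (rule isoE)
  show ?thesis
  proof (rule is_pullbackI)
    show "f \<cdot> (p \<cdot> c) = g \<cdot> (q \<cdot> c)"
      using pb d assms(3) by (metis assoc)
    show "\<exists>w \<in> Mor C. Dom C w = Dom C r \<and> Cod C w = Dom C (p \<cdot> c) \<and>
        (p \<cdot> c) \<cdot> w = r \<and> (q \<cdot> c) \<cdot> w = s"
      if rs: "r \<in> Mor C" "s \<in> Mor C" "Dom C r = Dom C s" "Cod C r = Dom C f" "Cod C s = Dom C g"
        "f \<cdot> r = g \<cdot> s" for r s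
    proof -
      obtain w where w: "w \<in> Mor C" "Dom C w = Dom C r" "Cod C w = Dom C p" "p \<cdot> w = r" "q \<cdot> w = s"
        by (rule pullback_lift[OF assms(1) rs(6) rs(1-5)])
      have "c \<cdot> (d \<cdot> w) = w"
        using d w assms(3) by (simp flip: assoc)
      then have "(p \<cdot> c) \<cdot> (d \<cdot> w) = r \<and> (q \<cdot> c) \<cdot> (d \<cdot> w) = s"
        using d w assms(3) pb by (simp add: assoc)
      then show ?thesis
        using d w assms(3) pb by (intro bexI[of _ "d \<cdot> w"]) auto
    qed
    show "v = w"
      if vw: "v \<in> Mor C" "w \<in> Mor C" "Dom C v = Dom C w" "Cod C v = Dom C (p \<cdot> c)"
        "Cod C w = Dom C (p \<cdot> c)" "(p \<cdot> c) \<cdot> v = (p \<cdot> c) \<cdot> w" "(q \<cdot> c) \<cdot> v = (q \<cdot> c) \<cdot> w" for v w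
    proof -
      have "c \<cdot> v = c \<cdot> w"
        by (rule pullback_joint_mono[OF assms(1)]) (use vw d pb assms(3) in \<open>simp_all add: assoc\<close>)
      then have "d \<cdot> (c \<cdot> v) = d \<cdot> (c \<cdot> w)"
        by simp
      then show ?thesis
        using vw d pb assms(3) by (simp add: absorb[OF d(5)])
    qed
  qed (use pb d assms(3) in simp_all)
qed

text \<open>Up to the isomorphism \<open>x\<close>, this is the pasting law for pullbacks: both \<open>p\<close> and
  \<open>p'\<close> are pullbacks along the same map, of \<open>g' \<cdot> y\<close> and of \<open>g'\<close>, so \<open>v\<close> is a pullback
  of \<open>y\<close>.\<close>

lemma pullback_comparison:
  assumes pb: "is_pullback C f g p q" and pb': "is_pullback C f' g' p' q'"
    and x: "iso C x" "Dom C x = Dom C f" "Cod C x = Dom C f'" "f' \<cdot> x = f"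
    and y: "y \<in> Mor C" "Cod C y = Dom C g'" "g' \<cdot> y = g"
    and v: "v \<in> Mor C" "Dom C v = Dom C p" "Cod C v = Dom C p'" "p' \<cdot> v = x \<cdot> p" "q' \<cdot> v = y \<cdot> q"
  shows "is_pullback C y q' q v"
proof -
  note PB = is_pullbackD(1-8)[OF pb] and PB' = is_pullbackD(1-8)[OF pb']
    and eq' = is_pullbackD(9)[OF pb']
  from x(1) obtain k where k: "x \<in> Mor C" "k \<in> Mor C" "Dom C k = Cod C x" "Cod C k = Dom C x"
    "k \<cdot> x = Idn C (Dom C x)" "x \<cdot> k = Idn C (Cod C x)"
    by (rule isoE)
  have doms: "Dom C y = Dom C g"
    using Dom_Comp[OF y(1) PB'(2) y(2)] y(3) by simp
  note sides = PB PB' k(1-4) x(2,3) y(1,2) v(1-3) doms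
  show ?thesis
  proof (rule is_pullbackI)
    show "\<exists>w \<in> Mor C. Dom C w = Dom C r \<and> Cod C w = Dom C q \<and> q \<cdot> w = r \<and> v \<cdot> w = s"
      if rs: "r \<in> Mor C" "s \<in> Mor C" "Dom C r = Dom C s" "Cod C r = Dom C y" "Cod C s = Dom C q'"
        "y \<cdot> r = q' \<cdot> s" for r s
    proof -
      have "f \<cdot> (k \<cdot> (p' \<cdot> s)) = f' \<cdot> (x \<cdot> (k \<cdot> (p' \<cdot> s)))"
        using sides rs(1-5) absorb[OF x(4), of "k \<cdot> (p' \<cdot> s)"] by simp
      also have "\<dots> = f' \<cdot> (p' \<cdot> s)"
        using sides rs(1-5) absorb[OF k(6), of "p' \<cdot> s"] by simp
      also have "\<dots> = g' \<cdot> (q' \<cdot> s)"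
        using sides rs(1-5) absorb[OF eq', of s] by (simp add: assoc)
      also have "\<dots> = g \<cdot> r"
        using sides rs(1-5) absorb[OF y(3), of r] by (simp flip: rs(6))
      finally obtain w where w: "w \<in> Mor C" "Dom C w = Dom C (k \<cdot> (p' \<cdot> s))" "Cod C w = Dom C p"
        "p \<cdot> w = k \<cdot> (p' \<cdot> s)" "q \<cdot> w = r"
        by (rule pullback_lift[OF pb]) (use sides rs(1-5) in simp_all)
      have dw: "Dom C w = Dom C s"
        using w(2) sides rs(2,5) by simp
      have "v \<cdot> w = s"
      proof (rule pullback_joint_mono[OF pb'])
        show "p' \<cdot> (v \<cdot> w) = p' \<cdot> s"
          using sides w(1,3) rs(2,5) absorb[OF v(4), of w] absorb[OF k(6), of "p' \<cdot> s"]
          by (simp add: assoc w(4))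
        show "q' \<cdot> (v \<cdot> w) = q' \<cdot> s"
          using sides w(1,3) absorb[OF v(5), of w] by (simp add: assoc w(5) rs(6))
      qed (use sides w(1,3) dw rs(2,5) in simp_all)
      then show ?thesis
        using w(1,3,5) dw rs(3) sides by (intro bexI[of _ w]) simp_all
    qed
    show "r = s"
      if rs: "r \<in> Mor C" "s \<in> Mor C" "Dom C r = Dom C s" "Cod C r = Dom C q" "Cod C s = Dom C q"
        "q \<cdot> r = q \<cdot> s" "v \<cdot> r = v \<cdot> s" for r s
    proof (rule pullback_joint_mono[OF pb _ rs(6)])
      have kpv: "k \<cdot> (p' \<cdot> v) = p"
        using sides absorb[OF k(5), of p] by (simp add: v(4))
      have "p \<cdot> z = k \<cdot> (p' \<cdot> (v \<cdot> z))" if "z \<in> Mor C" "Cod C z = Dom C q" for z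
        using sides that absorb[OF kpv, of z] by (simp add: assoc)
      then show "p \<cdot> r = p \<cdot> s"
        using rs(1,2,4,5,7) by simp
    qed (use sides rs(1-5) in simp_all)
  qed (use sides v(5) in simp_all)
qed

lemma split_mono_epi_iso:
  assumes "epi C h" "r \<in> Mor C" "Dom C r = Cod C h" "r \<cdot> h = Idn C (Dom C h)"
  shows "iso C h"
proof -
  have h: "h \<in> Mor C"
    using assms(1) by (simp add: epi_def)
  have cod: "Cod C r = Dom C h"
    using arg_cong[OF assms(4), of "Cod C"] h assms(2,3) by simp
  have "(h \<cdot> r) \<cdot> h = Idn C (Cod C h) \<cdot> h"
    using h assms cod by (simp add: assoc)
  then have "h \<cdot> r = Idn C (Cod C h)"
    by (rule epiD[OF assms(1)]) (use h assms cod in simp_all)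
  then show ?thesis
    using isoI[OF h assms(2,3) cod assms(4)] by simp
qed

lemma iso_cancel_epi:
  assumes "iso C (u \<cdot> h)" "epi C h" "u \<in> Mor C" "Cod C h = Dom C u"
  shows "iso C h"
proof -
  have h: "h \<in> Mor C"
    using assms(2) by (simp add: epi_def)
  from assms(1) obtain k where "k \<in> Mor C" "Dom C k = Cod C u" "k \<cdot> (u \<cdot> h) = Idn C (Dom C h)"
    by (rule isoE) (use assms h in simp)
  then show ?thesis
    using split_mono_epi_iso[of h "k \<cdot> u"] assms h by (simp add: assoc)
qed

end

section \<open>Images in regular categories\<close>

definition monic :: "('o, 'm) category \<Rightarrow> 'm \<Rightarrow> bool" where
  "monic Y f \<longleftrightarrow> f \<in> Mor Y \<and>
     (\<forall>g \<in> Mor Y. \<forall>h \<in> Mor Y. Dom Y g = Dom Y h \<and> Cod Y g = Dom Y f \<and> Cod Y h = Dom Y f \<and>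
        f \<cdot>\<^bsub>Y\<^esub> g = f \<cdot>\<^bsub>Y\<^esub> h \<longrightarrow> g = h)"

lemma monicD:
  "\<lbrakk>monic Y f; f \<cdot>\<^bsub>Y\<^esub> g = f \<cdot>\<^bsub>Y\<^esub> h; g \<in> Mor Y; h \<in> Mor Y; Dom Y g = Dom Y h;
    Cod Y g = Dom Y f; Cod Y h = Dom Y f\<rbrakk> \<Longrightarrow> g = h"
  unfolding monic_def by blast

lemma is_coequalizerD:
  assumes "is_coequalizer Y u v f"
  shows "u \<in> Mor Y" "v \<in> Mor Y" "f \<in> Mor Y" "Dom Y v = Dom Y u" "Cod Y u = Dom Y f"
    "Cod Y v = Dom Y f" "f \<cdot>\<^bsub>Y\<^esub> u = f \<cdot>\<^bsub>Y\<^esub> v"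
  using assms by (simp_all add: is_coequalizer_def)

lemma coequalizer_ex1:
  assumes "is_coequalizer Y u v f" "g \<in> Mor Y" "Dom Y g = Dom Y f" "g \<cdot>\<^bsub>Y\<^esub> u = g \<cdot>\<^bsub>Y\<^esub> v"
  shows "\<exists>!w. w \<in> hom Y (Cod Y f) (Cod Y g) \<and> w \<cdot>\<^bsub>Y\<^esub> f = g"
  using assms unfolding is_coequalizer_def by blast

lemma coequalizer_factor:
  assumes "is_coequalizer Y u v f" "g \<in> Mor Y" "Dom Y g = Dom Y f" "g \<cdot>\<^bsub>Y\<^esub> u = g \<cdot>\<^bsub>Y\<^esub> v"
  obtains w where "w \<in> Mor Y" "Dom Y w = Cod Y f" "Cod Y w = Cod Y g" "w \<cdot>\<^bsub>Y\<^esub> f = g"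
  using coequalizer_ex1[OF assms] that unfolding hom_def by blast

context category
begin

lemma coequalizer_epi:
  assumes "is_coequalizer C u v f"
  shows "epi C f"
  unfolding epi_def
proof (intro conjI ballI impI)
  note ce = is_coequalizerD[OF assms]
  show "f \<in> Mor C"
    by (fact ce)
  fix g h
  assume gh: "g \<in> Mor C" "h \<in> Mor C" "Dom C g = Cod C f \<and> Dom C h = Cod C f \<and> g \<cdot> f = h \<cdot> f"
  then have eq: "g \<cdot> f = h \<cdot> f" and cod: "Cod C g = Cod C h"
    using ce Cod_Comp[of f g] Cod_Comp[of f h] by auto
  have "(h \<cdot> f) \<cdot> u = (h \<cdot> f) \<cdot> v"
    using gh ce by (simp add: assoc)
  then show "g = h"
    using coequalizer_ex1[OF assms, of "h \<cdot> f"] gh ce eq cod by (auto simp: hom_def)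
qed

lemma regular_epi_epi: "regular_epi C f \<Longrightarrow> epi C f"
  unfolding regular_epi_def using coequalizer_epi by blast

lemma iso_regular_epi:
  assumes "iso C f"
  shows "regular_epi C f"
proof -
  from assms obtain g where g: "f \<in> Mor C" "g \<in> Mor C" "Dom C g = Cod C f" "Cod C g = Dom C f"
    "g \<cdot> f = Idn C (Dom C f)" "f \<cdot> g = Idn C (Cod C f)"
    by (rule isoE)
  have "is_coequalizer C (Idn C (Dom C f)) (Idn C (Dom C f)) f"
    unfolding is_coequalizer_def
  proof (intro conjI ballI impI)
    fix h assume h: "h \<in> Mor C" "Dom C h = Dom C f \<and> h \<cdot> Idn C (Dom C f) = h \<cdot> Idn C (Dom C f)"
    show "\<exists>!w. w \<in> hom C (Cod C f) (Cod C h) \<and> w \<cdot> f = h"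
    proof (rule ex1I[of _ "h \<cdot> g"])
      show "h \<cdot> g \<in> hom C (Cod C f) (Cod C h) \<and> (h \<cdot> g) \<cdot> f = h"
        using g h by (simp add: hom_def assoc)
    next
      fix w assume "w \<in> hom C (Cod C f) (Cod C h) \<and> w \<cdot> f = h"
      then show "w = h \<cdot> g"
        using g absorb[of w f h g] by (auto simp: hom_def assoc)
    qed
  qed (use g in simp_all)
  then show ?thesis
    unfolding regular_epi_def by blast
qed

lemma iso_Comp_regular_epi:
  assumes "regular_epi C e" "iso C m" "Cod C e = Dom C m"
  shows "regular_epi C (m \<cdot> e)"
proof -
  from assms(1) obtain u v where e: "is_coequalizer C u v e"
    unfolding regular_epi_def by blast
  note ce = is_coequalizerD[OF e]
  from assms(2) obtain k where k: "m \<in> Mor C" "k \<in> Mor C" "Dom C k = Cod C m" "Cod C k = Dom C m"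
    "k \<cdot> m = Idn C (Dom C m)" "m \<cdot> k = Idn C (Cod C m)"
    by (rule isoE)
  have "is_coequalizer C u v (m \<cdot> e)"
    unfolding is_coequalizer_def
  proof (intro conjI ballI impI)
    show "(m \<cdot> e) \<cdot> u = (m \<cdot> e) \<cdot> v"
      using ce k assms(3) by (simp add: assoc)
    fix h assume h: "h \<in> Mor C" "Dom C h = Dom C (m \<cdot> e) \<and> h \<cdot> u = h \<cdot> v"
    obtain w where w: "w \<in> Mor C" "Dom C w = Cod C e" "Cod C w = Cod C h" "w \<cdot> e = h"
      by (rule coequalizer_factor[OF e, of h]) (use h ce k assms(3) in auto)
    show "\<exists>!w. w \<in> hom C (Cod C (m \<cdot> e)) (Cod C h) \<and> w \<cdot> (m \<cdot> e) = h"
    proof (rule ex1I[of _ "w \<cdot> k"])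
      have "k \<cdot> (m \<cdot> e) = e"
        using ce k assms(3) by (simp add: absorb[OF k(5)])
      then show "w \<cdot> k \<in> hom C (Cod C (m \<cdot> e)) (Cod C h) \<and> (w \<cdot> k) \<cdot> (m \<cdot> e) = h"
        using w ce k assms(3) by (simp add: hom_def assoc)
    next
      fix x assume "x \<in> hom C (Cod C (m \<cdot> e)) (Cod C h) \<and> x \<cdot> (m \<cdot> e) = h"
      then have x: "x \<in> Mor C" "Dom C x = Cod C m" "Cod C x = Cod C h" "(x \<cdot> m) \<cdot> e = w \<cdot> e"
        using ce k assms(3) w by (auto simp: hom_def assoc)
      have "x \<cdot> m = w"
        by (rule epiD[OF coequalizer_epi[OF e] x(4)]) (use x k w assms(3) in simp_all)
      then show "x = w \<cdot> k"
        using x k by (auto simp: assoc)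
    qed
  qed (use ce k assms(3) in simp_all)
  then show ?thesis
    unfolding regular_epi_def by blast
qed

text \<open>Only the upper triangle of the diagonal fill-in is recorded; the lower one follows
  as \<open>e\<close> is epic.\<close>

lemma regular_epi_lift:
  assumes "regular_epi C e" "monic C m" "m \<cdot> x = y \<cdot> e"
    "x \<in> Mor C" "y \<in> Mor C" "Dom C x = Dom C e" "Cod C x = Dom C m" "Dom C y = Cod C e"
  obtains d where "d \<in> Mor C" "Dom C d = Cod C e" "Cod C d = Dom C m" "d \<cdot> e = x"
proof -
  from assms(1) obtain u v where e: "is_coequalizer C u v e"
    unfolding regular_epi_def by blast
  note ce = is_coequalizerD[OF e]
  have m: "m \<in> Mor C"
    using assms(2) by (simp add: monic_def)
  have "m \<cdot> (x \<cdot> u) = m \<cdot> (x \<cdot> v)"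
    using ce assms(3-8) m by (simp add: absorb[OF assms(3)] assoc)
  then have "x \<cdot> u = x \<cdot> v"
    by (rule monicD[OF assms(2)]) (use ce assms(3-8) m in simp_all)
  then show thesis
    using coequalizer_factor[OF e assms(4,6)] that assms(7) by metis
qed

text \<open>Lifting the identity against \<open>m\<close> gives a section of \<open>m\<close>, and a monomorphism with a
  section is invertible.\<close>

lemma regular_epi_through_mono:
  assumes "monic C m" "regular_epi C (m \<cdot> e)" "e \<in> Mor C" "Cod C e = Dom C m"
  shows "iso C m"
proof -
  have m: "m \<in> Mor C"
    using assms(1) by (simp add: monic_def)
  obtain d where d: "d \<in> Mor C" "Dom C d = Cod C m" "Cod C d = Dom C m" "d \<cdot> (m \<cdot> e) = e"
    by (rule regular_epi_lift[OF assms(2,1), of e "Idn C (Cod C m)"])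
      (use m assms(3,4) in simp_all)
  have "(m \<cdot> d) \<cdot> (m \<cdot> e) = Idn C (Cod C m) \<cdot> (m \<cdot> e)"
    using m d assms(3,4) by (simp add: assoc)
  then have md: "m \<cdot> d = Idn C (Cod C m)"
    by (rule epiD[OF regular_epi_epi[OF assms(2)]]) (use m d assms(3,4) in simp_all)
  then have "m \<cdot> (d \<cdot> m) = m \<cdot> Idn C (Dom C m)"
    using m d by (simp add: absorb[OF md])
  then have "d \<cdot> m = Idn C (Dom C m)"
    by (rule monicD[OF assms(1)]) (use m d in simp_all)
  then show ?thesis
    using isoI[OF m d(1-3) _ md] by simp
qed

end

context regular_category
begin

lemma image_factorization:
  assumes "f \<in> Mor C"
  obtains e m where "regular_epi C e" "monic C m" "e \<in> Mor C" "m \<in> Mor C" "Dom C e = Dom C f"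
    "Cod C e = Dom C m" "Cod C m = Cod C f" "m \<cdot> e = f"
proof -
  obtain p q where pq: "is_pullback C f f p q"
    using ex_pullback[OF assms assms] by blast
  note kp = is_pullbackD[OF pq]
  obtain e where e: "is_coequalizer C p q e"
    using ex_coequalizer_kernel_pair[OF pq] by blast
  note ce = is_coequalizerD[OF e]
  have re: "regular_epi C e"
    using e unfolding regular_epi_def by blast
  have dom: "Dom C e = Dom C f"
    using ce kp by simp
  obtain m where m: "m \<in> Mor C" "Dom C m = Cod C e" "Cod C m = Cod C f" "m \<cdot> e = f"
    by (rule coequalizer_factor[OF e assms]) (use dom kp in simp_all)
  have "monic C m"
    unfolding monic_def
  proof (intro conjI ballI impI)
    fix a b
    assume ab: "a \<in> Mor C" "b \<in> Mor C"
      "Dom C a = Dom C b \<and> Cod C a = Dom C m \<and> Cod C b = Dom C m \<and> m \<cdot> a = m \<cdot> b"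
    \<comment> \<open>A common regular-epimorphic cover \<open>x \<cdot> z = y \<cdot> z'\<close> of the domain of \<open>a\<close> and \<open>b\<close>, on
        which both lift along \<open>e\<close>; the two lifts are identified by \<open>f\<close>, hence by \<open>e\<close>.\<close>
    obtain x' x where x: "is_pullback C e a x' x"
      using ex_pullback[of e a] ab m ce by auto
    obtain y' y where y: "is_pullback C e b y' y"
      using ex_pullback[of e b] ab m ce by auto
    note X = is_pullbackD[OF x] and Y = is_pullbackD[OF y]
    obtain z z' where z: "is_pullback C x y z z'"
      using ex_pullback[of x y] ab X Y by auto
    note Z = is_pullbackD[OF z]
    have "regular_epi C y"
      using regular_epi_pullback[OF y re] .
    then have "epi C z"
      using regular_epi_epi regular_epi_pullback[OF pullback_sym[OF z]] by blast
    have "epi C x"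
      using regular_epi_epi regular_epi_pullback[OF x re] by blast
    have a: "a \<cdot> (x \<cdot> z) = e \<cdot> (x' \<cdot> z)"
      using ab X Z ce m by (simp add: absorb[OF X(9)] assoc)
    have b: "b \<cdot> (x \<cdot> z) = e \<cdot> (y' \<cdot> z')"
      using ab X Y Z ce m by (simp add: absorb[OF Y(9)] assoc)
    have "f \<cdot> (x' \<cdot> z) = m \<cdot> (e \<cdot> (x' \<cdot> z))"
      using ab X Z ce m by (simp add: absorb[OF m(4)])
    also have "\<dots> = m \<cdot> (b \<cdot> (x \<cdot> z))"
      using ab a X Z m absorb[of m a "m \<cdot> b" "x \<cdot> z"] by (simp add: assoc)
    also have "\<dots> = f \<cdot> (y' \<cdot> z')"
      using ab b Y Z ce m by (simp add: absorb[OF m(4)])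
    finally have eq: "f \<cdot> (x' \<cdot> z) = f \<cdot> (y' \<cdot> z')" .
    obtain w where w: "w \<in> Mor C" "Dom C w = Dom C (x' \<cdot> z)" "Cod C w = Dom C p"
      "p \<cdot> w = x' \<cdot> z" "q \<cdot> w = y' \<cdot> z'"
      by (rule pullback_lift[OF pq eq]) (use X Y Z ce dom in simp_all)
    have "e \<cdot> (x' \<cdot> z) = e \<cdot> (y' \<cdot> z')"
      using absorb[OF ce(7), of w] w kp ce by (simp add: assoc)
    then have "(a \<cdot> x) \<cdot> z = (b \<cdot> x) \<cdot> z"
      using a b ab X Z m by (simp add: assoc)
    then have "a \<cdot> x = b \<cdot> x"
      by (rule epiD[OF \<open>epi C z\<close>]) (use ab X Z m in simp_all)
    then show "a = b"
      by (rule epiD[OF \<open>epi C x\<close>]) (use ab X Z m in simp_all)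
  qed fact
  then show thesis
    using that[OF re _ ce(3) m(1) dom] m by simp
qed

text \<open>The monic part \<open>m\<close> of the image factorization of \<open>g \<cdot> f\<close> also lies on a
  factorization of \<open>g\<close>, by lifting \<open>f\<close> against \<open>m\<close>; therefore \<open>m\<close> is invertible.\<close>

lemma regular_epi_Comp:
  assumes "regular_epi C f" "regular_epi C g" "Cod C f = Dom C g"
  shows "regular_epi C (g \<cdot> f)"
proof -
  have fg: "f \<in> Mor C" "g \<in> Mor C"
    using assms regular_epi_epi by (auto simp: epi_def)
  obtain e m where em: "regular_epi C e" "monic C m" "e \<in> Mor C" "m \<in> Mor C" "Dom C e = Dom C f"
    "Cod C e = Dom C m" "Cod C m = Cod C g" "m \<cdot> e = g \<cdot> f"
    by (rule image_factorization[of "g \<cdot> f"]) (use fg assms(3) in simp_all)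
  obtain d where d: "d \<in> Mor C" "Dom C d = Cod C f" "Cod C d = Dom C m" "d \<cdot> f = e"
    by (rule regular_epi_lift[OF assms(1) em(2,8)]) (use fg em assms(3) in simp_all)
  have "(m \<cdot> d) \<cdot> f = g \<cdot> f"
    using fg em d assms(3) by (simp add: assoc)
  then have "m \<cdot> d = g"
    by (rule epiD[OF regular_epi_epi[OF assms(1)]]) (use fg em d assms(3) in simp_all)
  then have "iso C m"
    using regular_epi_through_mono[of m d] em d assms(2) by simp
  then show ?thesis
    using iso_Comp_regular_epi[OF em(1) _ em(6)] em(8) by simp
qed

lemma regular_epi_cancel:
  assumes "regular_epi C (g \<cdot> f)" "f \<in> Mor C" "g \<in> Mor C" "Cod C f = Dom C g"
  shows "regular_epi C g"
proof -
  obtain e m where em: "regular_epi C e" "monic C m" "e \<in> Mor C" "m \<in> Mor C" "Dom C e = Dom C g"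
    "Cod C e = Dom C m" "Cod C m = Cod C g" "m \<cdot> e = g"
    by (rule image_factorization[OF assms(3)])
  have "m \<cdot> (e \<cdot> f) = g \<cdot> f"
    using em assms by (simp add: absorb[OF em(8)])
  then have "iso C m"
    using regular_epi_through_mono[of m "e \<cdot> f"] em assms by simp
  then show ?thesis
    using iso_Comp_regular_epi[OF em(1) _ em(6)] em(8) by simp
qed

end

text \<open>The copy of a category inside \<open>cell\<close> has its morphisms wrapped by an injective
  constructor. The following rule carries the universal properties of limits and
  colimits over to it.\<close>

lemma bex1_inj_image:
  assumes "inj k"
  shows "(\<exists>!x. x \<in> k ` A \<and> P x) \<longleftrightarrow> (\<exists>!x. x \<in> A \<and> P (k x))" (is "?L \<longleftrightarrow> ?R")
proof
  assume ?L
  then show ?R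
  proof (rule ex1E)
    fix z assume z: "z \<in> k ` A \<and> P z" and uniq: "\<forall>y. y \<in> k ` A \<and> P y \<longrightarrow> y = z"
    then obtain x where x: "x \<in> A" "z = k x"
      by blast
    show ?R
    proof (rule ex1I[of _ x])
      show "x \<in> A \<and> P (k x)"
        using x z by simp
      fix y assume "y \<in> A \<and> P (k y)"
      then have "k y = z"
        by (intro uniq[rule_format]) simp
      then show "y = x"
        unfolding x(2) by (rule injD[OF assms])
    qed
  qed
next
  assume ?R
  then show ?L
  proof (rule ex1E)
    fix x assume x: "x \<in> A \<and> P (k x)" and uniq: "\<forall>y. y \<in> A \<and> P (k y) \<longrightarrow> y = x"
    show ?L
    proof (rule ex1I[of _ "k x"])
      show "k x \<in> k ` A \<and> P (k x)"
        using x by simp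
      fix y assume "y \<in> k ` A \<and> P y"
      then obtain y' where "y' \<in> A \<and> P (k y')" "y = k y'"
        by blast
      then show "y = k x"
        using uniq[rule_format, of y'] by simp
    qed
  qed
qed

lemma base_category_simps [simp]:
  "Ob (base_category C) = Vertex ` Ob C"
  "Mor (base_category C) = Edge ` Mor C"
  "Dom (base_category C) (Edge f) = Vertex (Dom C f)"
  "Cod (base_category C) (Edge f) = Vertex (Cod C f)"
  "Idn (base_category C) (Vertex a) = Edge (Idn C a)"
  "Edge g \<cdot>\<^bsub>base_category C\<^esub> Edge f = Edge (g \<cdot>\<^bsub>C\<^esub> f)"
  by (simp_all add: base_category_def)

lemma hom_base_category [simp]:
  "hom (base_category C) (Vertex a) (Vertex b) = Edge ` hom C a b"
  by (auto simp: hom_def)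

lemma inj_Edge: "inj Edge"
  by (simp add: inj_def)

lemma is_pullback_base_category:
  "is_pullback (base_category C) (Edge f) (Edge g) (Edge p) (Edge q) \<longleftrightarrow> is_pullback C f g p q"
  unfolding is_pullback_def
  by (simp add: bex1_inj_image[OF inj_Edge] inj_image_mem_iff[OF inj_Edge])

lemma is_coequalizer_base_category:
  "is_coequalizer (base_category C) (Edge u) (Edge v) (Edge f) \<longleftrightarrow> is_coequalizer C u v f"
  unfolding is_coequalizer_def
  by (simp add: bex1_inj_image[OF inj_Edge] inj_image_mem_iff[OF inj_Edge])

lemma is_terminal_base_category:
  fixes C :: "('o, 'm) category"
  shows "is_terminal (base_category C) (Vertex t) \<longleftrightarrow> is_terminal C t"
proof -
  have "(\<exists>!f :: ('o, 'm) cell. f \<in> Edge ` A) \<longleftrightarrow> (\<exists>!f. f \<in> A)" for A :: "'m set"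
    using bex1_inj_image[OF inj_Edge, of A "\<lambda>_. True"] by simp
  then show ?thesis
    unfolding is_terminal_def by (simp add: inj_image_mem_iff inj_def)
qed

lemma regular_epi_base_category:
  "regular_epi (base_category C) (Edge f) \<longleftrightarrow> regular_epi C f"
proof
  assume "regular_epi (base_category C) (Edge f)"
  then obtain u v where uv: "is_coequalizer (base_category C) u v (Edge f)"
    unfolding regular_epi_def by blast
  then obtain u' v' where "u = Edge u'" "v = Edge v'"
    using is_coequalizerD(1,2)[OF uv] by auto
  then have "is_coequalizer C u' v' f"
    using uv by (simp add: is_coequalizer_base_category)
  then show "regular_epi C f"
    unfolding regular_epi_def by blast
next
  assume "regular_epi C f"
  then obtain u v where "is_coequalizer C u v f"
    unfolding regular_epi_def by blast
  then have "is_coequalizer (base_category C) (Edge u) (Edge v) (Edge f)"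
    by (simp add: is_coequalizer_base_category)
  then show "regular_epi (base_category C) (Edge f)"
    unfolding regular_epi_def by blast
qed

lemma category_base_category:
  assumes "category C"
  shows "category (base_category C)"
proof -
  interpret category C by fact
  have hom_base: "\<exists>f' a' b'. f = Edge f' \<and> a = Vertex a' \<and> b = Vertex b' \<and> f' \<in> hom C a' b'"
    if "f \<in> hom (base_category C) a b" for f a b
    using that by (auto simp: hom_def)
  show ?thesis
  proof
    fix f a b assume f: "f \<in> hom (base_category C) a b"
    then obtain f' a' b' where f': "f = Edge f'" "a = Vertex a'" "b = Vertex b'" "f' \<in> hom C a' b'"
      using hom_base by blast
    show "f \<cdot>\<^bsub>base_category C\<^esub> Idn (base_category C) a = f"
      and "Idn (base_category C) b \<cdot>\<^bsub>base_category C\<^esub> f = f"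
      using f' Comp_Idn[OF f'(4)] Idn_Comp[OF f'(4)] by simp_all
    fix g c assume g: "g \<in> hom (base_category C) b c"
    then obtain g' c' where g': "g = Edge g'" "c = Vertex c'" "g' \<in> hom C b' c'"
      using hom_base f'(3) by blast
    show "g \<cdot>\<^bsub>base_category C\<^esub> f \<in> hom (base_category C) a c"
      using f' g' Comp_hom[OF f'(4) g'(3)] by simp
    fix h d assume "h \<in> hom (base_category C) c d"
    then obtain h' d' where h': "h = Edge h'" "h' \<in> hom C c' d'"
      using hom_base g'(2) by blast
    show "(h \<cdot>\<^bsub>base_category C\<^esub> g) \<cdot>\<^bsub>base_category C\<^esub> f =
        h \<cdot>\<^bsub>base_category C\<^esub> (g \<cdot>\<^bsub>base_category C\<^esub> f)"
      using f' g' h' Comp_assoc[OF f'(4) g'(3) h'(2)] by simp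
  qed (use Idn_hom in auto)
qed

lemma regular_category_base_category:
  assumes "regular_category C"
  shows "regular_category (base_category C)"
proof -
  interpret regular_category C by fact
  show ?thesis
  proof (intro regular_category.intro finitely_complete_category.intro
      category_base_category[OF category_axioms] finitely_complete_category_axioms.intro
      regular_category_axioms.intro)
    show "\<exists>t. is_terminal (base_category C) t"
    proof -
      obtain t where "is_terminal C t"
        using ex_terminal by blast
      then have "is_terminal (base_category C) (Vertex t)"
        by (simp add: is_terminal_base_category)
      then show ?thesis ..
    qed
    show "\<exists>p q. is_pullback (base_category C) f g p q"
      if fg: "f \<in> Mor (base_category C)" "g \<in> Mor (base_category C)"
        "Cod (base_category C) f = Cod (base_category C) g" for f g
    proof -
      from fg obtain f' g' where f': "f = Edge f'" "g = Edge g'" "f' \<in> Mor C" "g' \<in> Mor C"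
        "Cod C f' = Cod C g'"
        by auto
      then obtain p q where "is_pullback C f' g' p q"
        using ex_pullback by blast
      then have "is_pullback (base_category C) f g (Edge p) (Edge q)"
        using f' by (simp add: is_pullback_base_category)
      then show ?thesis
        by blast
    qed
    show "\<exists>e. is_coequalizer (base_category C) p q e"
      if pq: "is_pullback (base_category C) f f p q" for f p q
    proof -
      from is_pullbackD(1,3,4)[OF pq]
      obtain f' p' q' where f': "f = Edge f'" "p = Edge p'" "q = Edge q'"
        by auto
      then have "is_pullback C f' f' p' q'"
        using pq by (simp add: is_pullback_base_category)
      then obtain e where "is_coequalizer C p' q' e"
        using ex_coequalizer_kernel_pair by blast
      then have "is_coequalizer (base_category C) p q (Edge e)"
        using f' by (simp add: is_coequalizer_base_category)
      then show ?thesis ..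
    qed
    show "regular_epi (base_category C) q"
      if pq: "is_pullback (base_category C) f g p q" and "regular_epi (base_category C) f" for f g p q
    proof -
      from is_pullbackD(1-4)[OF pq] obtain f' g' p' q'
        where f': "f = Edge f'" "g = Edge g'" "p = Edge p'" "q = Edge q'"
        by auto
      then have "is_pullback C f' g' p' q'" "regular_epi C f'"
        using that by (simp_all add: is_pullback_base_category regular_epi_base_category)
      then have "regular_epi C q'"
        by (rule regular_epi_pullback)
      then show ?thesis
        using f'(4) by (simp add: regular_epi_base_category)
    qed
  qed
qed

section \<open>Corner classes\<close>

text \<open>The part of a Galois structure that concerns the extensions alone.\<close>

locale extension_category = category Y for Y :: "('o, 'm) category" (structure) +
  fixes E :: "'m set"
  assumes ext_epi: "f \<in> E \<Longrightarrow> epi Y f"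
    and iso_ext: "iso Y f \<Longrightarrow> f \<in> E"
    and Comp_ext: "\<lbrakk>f \<in> E; g \<in> E; Cod Y f = Dom Y g\<rbrakk> \<Longrightarrow> g \<cdot> f \<in> E"
    and ex_pullback_ext:
      "\<lbrakk>e \<in> E; g \<in> Mor Y; Cod Y e = Cod Y g\<rbrakk> \<Longrightarrow> \<exists>p q. is_pullback Y e g p q"
    and pullback_ext: "\<lbrakk>is_pullback Y e g p q; e \<in> E\<rbrakk> \<Longrightarrow> q \<in> E"
begin

lemma ext_Mor [simp]: "f \<in> E \<Longrightarrow> f \<in> Mor Y"
  using ext_epi by (simp add: epi_def)

lemma pullback_ext': "\<lbrakk>is_pullback Y f e p q; e \<in> E\<rbrakk> \<Longrightarrow> p \<in> E"
  using pullback_ext pullback_sym by blast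

end

lemma (in galois_structure) extension_category: "extension_category Y E"
proof -
  have Y: "category Y"
    using full_replete by (simp add: full_replete_subcategory_def)
  show ?thesis
  proof (intro extension_category.intro[OF Y] extension_category_axioms.intro)
    show "epi Y f" if "f \<in> E" for f
      using category.regular_epi_epi[OF Y] ext_regular_epi[OF that] .
    show "q \<in> E" if "is_pullback Y e g p q" "e \<in> E" for e g p q
      using that by (rule pullback_ext)
  qed (use iso_ext Comp_ext ex_pullback_ext in blast)+
qed

definition right_lifting :: "('o, 'm) category \<Rightarrow> 'm set \<Rightarrow> 'm \<Rightarrow> bool" where
  "right_lifting Y K p \<longleftrightarrow>
     (\<forall>e \<in> K. \<forall>x \<in> Mor Y. \<forall>z \<in> Mor Y.
        Dom Y x = Dom Y e \<and> Cod Y x = Dom Y p \<and> Dom Y z = Cod Y e \<and> Cod Y z = Cod Y p \<and>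
        p \<cdot>\<^bsub>Y\<^esub> x = z \<cdot>\<^bsub>Y\<^esub> e \<longrightarrow>
        (\<exists>d \<in> hom Y (Cod Y e) (Dom Y p). d \<cdot>\<^bsub>Y\<^esub> e = x \<and> p \<cdot>\<^bsub>Y\<^esub> d = z))"

lemma right_liftingE:
  assumes "right_lifting Y K p" "e \<in> K" "p \<cdot>\<^bsub>Y\<^esub> x = z \<cdot>\<^bsub>Y\<^esub> e" "x \<in> Mor Y" "z \<in> Mor Y"
    "Dom Y x = Dom Y e" "Cod Y x = Dom Y p" "Dom Y z = Cod Y e" "Cod Y z = Cod Y p"
  obtains d where "d \<in> Mor Y" "Dom Y d = Cod Y e" "Cod Y d = Dom Y p"
    "d \<cdot>\<^bsub>Y\<^esub> e = x" "p \<cdot>\<^bsub>Y\<^esub> d = z"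
  using assms unfolding right_lifting_def hom_def by blast

text \<open>The properties of corner morphisms (the class \<open>K\<close>) and extensions on which
  everything rests. The factorization produces the coverings used to analyse units;
  \<open>corner_cancel\<close> detects corner morphisms among extensions. The last property is a
  substitute for images. The pair \<open>r\<close>, \<open>s\<close> is a cocone over the span of \<open>\<alpha>\<close> and the
  corner extension \<open>h\<close>; the morphism \<open>q\<close> is the image of \<open>r\<close> at the corner, and it comes
  with a quotient \<open>t\<close> of the codomain of \<open>h\<close>.\<close>

locale corner_class =
  fixes Y :: "('o, 'm) category" (structure) and E K :: "'m set"
  assumes corner_Mor: "c \<in> K \<Longrightarrow> c \<in> Mor Y"
    and corner_factorization:
      "f \<in> E \<Longrightarrow> \<exists>c \<in> K. \<exists>p \<in> E. Cod Y c = Dom Y p \<and> p \<cdot> c = f \<and> right_lifting Y K p"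
    and corner_cancel:
      "\<lbrakk>h \<in> E; u \<in> Mor Y; Cod Y h = Dom Y u; u \<cdot> h \<in> K\<rbrakk> \<Longrightarrow> h \<in> K"
    and ext_cancel:
      "\<lbrakk>q \<in> E; g \<in> Mor Y; Cod Y q = Dom Y g; g \<cdot> q \<in> E\<rbrakk> \<Longrightarrow> g \<in> E"
    and corner_image:
      "\<lbrakk>\<alpha> \<in> E; h \<in> E; h \<in> K; r \<in> Mor Y; s \<in> Mor Y; Dom Y h = Dom Y \<alpha>; Dom Y r = Cod Y \<alpha>;
        Dom Y s = Cod Y h; r \<cdot> \<alpha> = s \<cdot> h\<rbrakk>
      \<Longrightarrow> \<exists>q \<in> E \<inter> K. \<exists>i \<in> Mor Y. \<exists>t \<in> E. Dom Y q = Cod Y \<alpha> \<and> Dom Y i = Cod Y q \<and>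
            Dom Y t = Cod Y h \<and> Cod Y t = Cod Y q \<and> i \<cdot> q = r \<and> t \<cdot> h = q \<cdot> \<alpha>"

text \<open>A cube of dimension zero consists of its initial vertex only, so all morphisms of
  the base category are corner morphisms. Identities have the lifting property against
  all morphisms, and \<open>q\<close> is the regular epimorphic part of the image factorization of
  \<open>r\<close>.\<close>

lemma (in regular_category) corner_class_all:
  "corner_class C {f. regular_epi C f} (Mor C)"
proof
  show "\<exists>c \<in> Mor C. \<exists>p \<in> {f. regular_epi C f}. Cod C c = Dom C p \<and> p \<cdot> c = f \<and>
      right_lifting C (Mor C) p"
    if "f \<in> {f. regular_epi C f}" for f
  proof -
    have f: "f \<in> Mor C"
      using that regular_epi_epi by (auto simp: epi_def)
    have "right_lifting C (Mor C) (Idn C (Cod C f))"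
      using f by (auto simp: right_lifting_def hom_def)
    then show ?thesis
      using f iso_regular_epi[OF iso_Idn, of "Cod C f"]
      by (intro bexI[of _ f] bexI[of _ "Idn C (Cod C f)"]) auto
  qed
  show "g \<in> {f. regular_epi C f}"
    if "q \<in> {f. regular_epi C f}" "g \<in> Mor C" "Cod C q = Dom C g"
      "g \<cdot> q \<in> {f. regular_epi C f}" for q g
    using that regular_epi_cancel regular_epi_epi unfolding epi_def by blast
  show "\<exists>q \<in> {f. regular_epi C f} \<inter> Mor C. \<exists>i \<in> Mor C. \<exists>t \<in> {f. regular_epi C f}.
      Dom C q = Cod C \<alpha> \<and> Dom C i = Cod C q \<and> Dom C t = Cod C h \<and> Cod C t = Cod C q \<and>
      i \<cdot> q = r \<and> t \<cdot> h = q \<cdot> \<alpha>"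
    if asm: "\<alpha> \<in> {f. regular_epi C f}" "h \<in> {f. regular_epi C f}" "h \<in> Mor C" "r \<in> Mor C" "s \<in> Mor C"
      "Dom C h = Dom C \<alpha>" "Dom C r = Cod C \<alpha>" "Dom C s = Cod C h" "r \<cdot> \<alpha> = s \<cdot> h" for \<alpha> h r s
  proof -
    have a: "regular_epi C \<alpha>" "regular_epi C h" "\<alpha> \<in> Mor C"
      using asm(1,2) regular_epi_epi by (auto simp: epi_def)
    obtain q i where q: "regular_epi C q" "monic C i" "q \<in> Mor C" "i \<in> Mor C" "Dom C q = Dom C r"
      "Cod C q = Dom C i" "Cod C i = Cod C r" "i \<cdot> q = r"
      by (rule image_factorization[OF asm(4)])
    have "i \<cdot> (q \<cdot> \<alpha>) = s \<cdot> h"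
      using a q asm by (simp add: absorb[OF q(8)])
    then obtain t where t: "t \<in> Mor C" "Dom C t = Cod C h" "Cod C t = Dom C i" "t \<cdot> h = q \<cdot> \<alpha>"
      by (rule regular_epi_lift[OF a(2) q(2)]) (use a q asm in simp_all)
    have "regular_epi C (t \<cdot> h)"
      using t regular_epi_Comp[OF a(1) q(1)] q asm by simp
    then have "regular_epi C t"
      using regular_epi_cancel[of t h] asm t by simp
    then show ?thesis
      using q t asm by (intro bexI[of _ q] bexI[of _ i] bexI[of _ t]) auto
  qed
qed (auto dest: regular_epi_epi simp: epi_def)

section \<open>Corner classes of squares\<close>

lemma Ext_simps [simp]:
  "Ob (Ext Y E) = Mor Y \<inter> E"
  "Dom (Ext Y E) = sq_dom"
  "Cod (Ext Y E) = sq_cod"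
  "Idn (Ext Y E) f = Square f f (Idn Y (Dom Y f)) (Idn Y (Cod Y f))"
  "\<beta> \<cdot>\<^bsub>Ext Y E\<^esub> \<alpha> = Square (sq_dom \<alpha>) (sq_cod \<beta>)
     (sq_top \<beta> \<cdot>\<^bsub>Y\<^esub> sq_top \<alpha>) (sq_bot \<beta> \<cdot>\<^bsub>Y\<^esub> sq_bot \<alpha>)"
  by (simp_all add: Ext_def full_subcategory_def Arr_def)

lemma Square_Mor_Ext [simp]:
  "Square fA fB t b \<in> Mor (Ext Y E) \<longleftrightarrow>
     fA \<in> Mor Y \<and> fB \<in> Mor Y \<and> fA \<in> E \<and> fB \<in> E \<and>
     t \<in> Mor Y \<and> Dom Y t = Dom Y fA \<and> Cod Y t = Dom Y fB \<and>
     b \<in> Mor Y \<and> Dom Y b = Cod Y fA \<and> Cod Y b = Cod Y fB \<and> fB \<cdot>\<^bsub>Y\<^esub> t = b \<cdot>\<^bsub>Y\<^esub> fA"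
  by (auto simp: Ext_def full_subcategory_def Arr_def hom_def)

lemma Mor_ExtE:
  assumes "\<alpha> \<in> Mor (Ext Y E)"
  obtains fA fB t b where "\<alpha> = Square fA fB t b" "fA \<in> Mor Y" "fB \<in> Mor Y" "fA \<in> E" "fB \<in> E"
    "t \<in> Mor Y" "Dom Y t = Dom Y fA" "Cod Y t = Dom Y fB"
    "b \<in> Mor Y" "Dom Y b = Cod Y fA" "Cod Y b = Cod Y fB" "fB \<cdot>\<^bsub>Y\<^esub> t = b \<cdot>\<^bsub>Y\<^esub> fA"
proof -
  obtain fA fB t b where "\<alpha> = Square fA fB t b"
    using assms by (auto simp: Ext_def full_subcategory_def Arr_def)
  then show thesis
    using that[of fA fB t b] assms by simp
qed

text \<open>The initial vertex of a cube, seen as a morphism of cubes of lower dimension, is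
  the initial vertex of the domain of this morphism. Hence the top component is a corner
  morphism one dimension lower, whereas the bottom component has to be invertible at all
  vertices.\<close>

definition corner_squares ::
  "('o, 'm) cell_category \<Rightarrow> ('o, 'm) cell set \<Rightarrow> ('o, 'm) cell set \<Rightarrow> ('o, 'm) cell set" where
  "corner_squares Y E K = {\<alpha> \<in> Mor (Ext Y E). sq_top \<alpha> \<in> K \<and> iso Y (sq_bot \<alpha>)}"

locale extension_cells = extension_category Y E
  for Y :: "('o, 'm) cell_category" (structure) and E :: "('o, 'm) cell set"
begin

lemma double_extensionsI:
  assumes "fA \<in> E" "fB \<in> E" "t \<in> E" "b \<in> E" "Dom Y t = Dom Y fA" "Cod Y t = Dom Y fB"
    "Dom Y b = Cod Y fA" "fB \<cdot> t = b \<cdot> fA"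
    and pb: "is_pullback Y b fB p q"
    and c: "c \<in> E" "Dom Y c = Dom Y fA" "Cod Y c = Dom Y p" "p \<cdot> c = fA" "q \<cdot> c = t"
  shows "Square fA fB t b \<in> double_extensions Y E"
proof -
  have "Cod Y b = Cod Y fB" "p \<in> E" "q \<in> E"
    using assms(2,4) is_pullbackD(5)[OF pb] pullback_ext[OF pb] pullback_ext'[OF pb] by simp_all
  then have "double_extension Y E fA fB t b"
    unfolding double_extension_def
    by (intro conjI exI[of _ p] exI[of _ q] exI[of _ c]) (use assms in \<open>simp_all add: hom_def\<close>)
  then show ?thesis
    using assms(1-8) \<open>Cod Y b = Cod Y fB\<close> by (simp add: double_extensions_def)
qed

lemma double_extensionsE:
  assumes "\<alpha> \<in> double_extensions Y E"
  obtains fA fB t b p q c where "\<alpha> = Square fA fB t b" "fA \<in> E" "fB \<in> E" "t \<in> E" "b \<in> E"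
    "Dom Y t = Dom Y fA" "Cod Y t = Dom Y fB" "Dom Y b = Cod Y fA" "Cod Y b = Cod Y fB"
    "fB \<cdot> t = b \<cdot> fA" "is_pullback Y b fB p q" "c \<in> E" "Dom Y c = Dom Y fA"
    "Cod Y c = Dom Y p" "p \<cdot> c = fA" "q \<cdot> c = t"
proof -
  from assms have "\<alpha> \<in> Mor (Ext Y E)"
    and de: "double_extension Y E (sq_dom \<alpha>) (sq_cod \<alpha>) (sq_top \<alpha>) (sq_bot \<alpha>)"
    by (auto simp: double_extensions_def)
  from this(1) obtain fA fB t b where \<alpha>: "\<alpha> = Square fA fB t b"
    by (rule Mor_ExtE)
  from de obtain p q c where "is_pullback Y b fB p q" "c \<in> hom Y (Dom Y fA) (Dom Y p)"
    "p \<cdot> c = fA" "q \<cdot> c = t" "c \<in> E"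
    unfolding double_extension_def \<alpha> by auto
  then show thesis
    using that[of fA fB t b p q c] \<alpha> de unfolding double_extension_def hom_def by auto
qed

lemma double_extensions_Mor: "\<alpha> \<in> double_extensions Y E \<Longrightarrow> \<alpha> \<in> Mor (Ext Y E)"
  by (simp add: double_extensions_def)

lemma double_extensions_epi:
  assumes "\<alpha> \<in> double_extensions Y E"
  shows "epi (Ext Y E) \<alpha>"
  unfolding epi_def
proof (intro conjI ballI impI)
  show "\<alpha> \<in> Mor (Ext Y E)"
    using assms by (rule double_extensions_Mor)
  fix g h
  assume gh: "g \<in> Mor (Ext Y E)" "h \<in> Mor (Ext Y E)"
    "Dom (Ext Y E) g = Cod (Ext Y E) \<alpha> \<and> Dom (Ext Y E) h = Cod (Ext Y E) \<alpha> \<and>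
      g \<cdot>\<^bsub>Ext Y E\<^esub> \<alpha> = h \<cdot>\<^bsub>Ext Y E\<^esub> \<alpha>"
  from assms obtain fA fB t b where \<alpha>: "\<alpha> = Square fA fB t b" "t \<in> E" "b \<in> E"
    "Cod Y t = Dom Y fB" "Cod Y b = Cod Y fB"
    by (rule double_extensionsE)
  have dom: "sq_dom g = fB" "sq_dom h = fB"
    using gh(3) \<alpha>(1) by simp_all
  from gh(1) obtain fC gt gb where g: "g = Square fB fC gt gb" "gt \<in> Mor Y" "gb \<in> Mor Y"
    "Dom Y gt = Dom Y fB" "Dom Y gb = Cod Y fB"
    by (rule Mor_ExtE) (use dom(1) in simp)
  from gh(2) obtain fC' ht hb where h: "h = Square fB fC' ht hb" "ht \<in> Mor Y" "hb \<in> Mor Y"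
    "Dom Y ht = Dom Y fB" "Dom Y hb = Cod Y fB"
    by (rule Mor_ExtE) (use dom(2) in simp)
  have eq: "fC = fC'" "gt \<cdot> t = ht \<cdot> t" "gb \<cdot> b = hb \<cdot> b"
    using gh(3) g(1) h(1) \<alpha>(1) by simp_all
  have "gt = ht"
    by (rule epiD[OF ext_epi[OF \<alpha>(2)] eq(2)]) (use \<alpha> g h in simp_all)
  moreover have "gb = hb"
    by (rule epiD[OF ext_epi[OF \<alpha>(3)] eq(3)]) (use \<alpha> g h in simp_all)
  ultimately show "g = h"
    using g(1) h(1) eq(1) by simp
qed

lemma double_extension_iso_bottom:
  assumes "fA \<in> E" "fB \<in> E" "t \<in> E" "iso Y b" "Dom Y t = Dom Y fA" "Cod Y t = Dom Y fB"
    "Dom Y b = Cod Y fA" "Cod Y b = Cod Y fB" "fB \<cdot> t = b \<cdot> fA"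
  shows "Square fA fB t b \<in> double_extensions Y E"
proof -
  from assms(4) obtain k where k: "b \<in> Mor Y" "k \<in> Mor Y" "Dom Y k = Cod Y b" "Cod Y k = Dom Y b"
    "k \<cdot> b = Idn Y (Dom Y b)" "b \<cdot> k = Idn Y (Cod Y b)"
    by (rule isoE)
  have pb: "is_pullback Y b fB (k \<cdot> fB) (Idn Y (Dom Y fB))"
    by (rule pullback_along_iso) (use assms k in simp_all)
  have "(k \<cdot> fB) \<cdot> t = fA"
    using assms k absorb[OF k(5), of fA] by (simp add: assoc)
  then show ?thesis
    using double_extensionsI[OF assms(1-3) iso_ext[OF assms(4)] assms(5-7,9) pb, of t] assms k
    by simp
qed

end

locale corner_cells = extension_cells Y E + corner_class Y E K
  for Y :: "('o, 'm) cell_category" (structure) and E K :: "('o, 'm) cell set"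
begin

abbreviation "E' \<equiv> double_extensions Y E"
abbreviation "K' \<equiv> corner_squares Y E K"

lemma corner_squaresE:
  assumes "\<alpha> \<in> K'"
  obtains fA fB t b k where "\<alpha> = Square fA fB t b" "t \<in> K" "iso Y b" "fA \<in> E" "fB \<in> E"
    "t \<in> Mor Y" "Dom Y t = Dom Y fA" "Cod Y t = Dom Y fB" "b \<in> Mor Y" "Dom Y b = Cod Y fA"
    "Cod Y b = Cod Y fB" "fB \<cdot> t = b \<cdot> fA"
    "k \<in> Mor Y" "Dom Y k = Cod Y fB" "Cod Y k = Cod Y fA"
    "k \<cdot> b = Idn Y (Cod Y fA)" "b \<cdot> k = Idn Y (Cod Y fB)"
proof -
  from assms have \<alpha>: "\<alpha> \<in> Mor (Ext Y E)" "sq_top \<alpha> \<in> K" "iso Y (sq_bot \<alpha>)"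
    by (auto simp: corner_squares_def)
  from \<alpha>(1) obtain fA fB t b where sq: "\<alpha> = Square fA fB t b" "fA \<in> E" "fB \<in> E"
    "t \<in> Mor Y" "Dom Y t = Dom Y fA" "Cod Y t = Dom Y fB" "b \<in> Mor Y" "Dom Y b = Cod Y fA"
    "Cod Y b = Cod Y fB" "fB \<cdot> t = b \<cdot> fA"
    by (rule Mor_ExtE)
  then have "iso Y b" "t \<in> K"
    using \<alpha> by simp_all
  from this(1) obtain k where "k \<in> Mor Y" "Dom Y k = Cod Y b" "Cod Y k = Dom Y b"
    "k \<cdot> b = Idn Y (Dom Y b)" "b \<cdot> k = Idn Y (Cod Y b)"
    by (rule isoE)
  then show thesis
    using that[of fA fB t b k] sq \<open>iso Y b\<close> \<open>t \<in> K\<close> by simp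
qed

text \<open>Factor the comparison map \<open>c0\<close> to the pullback one dimension lower, as \<open>p0 \<cdot> c1\<close>.
  Inserting the domain of \<open>p0\<close> between \<open>f\<close> and its pullback square changes only the
  corner, and the comparison map of the new square is \<open>p0\<close>. A lifting problem against a
  corner square has a unique solution on the bottom; it induces a map to the pullback,
  and what remains is a lifting problem for \<open>p0\<close>.\<close>

lemma corner_factorization_square:
  assumes "f \<in> E'"
  shows "\<exists>c \<in> K'. \<exists>p \<in> E'. Cod (Ext Y E) c = Dom (Ext Y E) p \<and> p \<cdot>\<^bsub>Ext Y E\<^esub> c = f \<and>
    right_lifting (Ext Y E) K' p"
proof -
  from assms obtain fX fY t b p q c0 where f: "f = Square fX fY t b" "fX \<in> E" "fY \<in> E" "t \<in> E"
    "b \<in> E" "Dom Y t = Dom Y fX" "Cod Y t = Dom Y fY" "Dom Y b = Cod Y fX" "Cod Y b = Cod Y fY"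
    "fY \<cdot> t = b \<cdot> fX" and pb: "is_pullback Y b fY p q"
    and c0: "c0 \<in> E" "Dom Y c0 = Dom Y fX" "Cod Y c0 = Dom Y p" "p \<cdot> c0 = fX" "q \<cdot> c0 = t"
    by (rule double_extensionsE)
  note PB = is_pullbackD[OF pb]
  have pq: "p \<in> E" "q \<in> E"
    using pullback_ext[OF pb] pullback_ext'[OF pb] f by simp_all
  obtain c1 p0 where c1: "c1 \<in> K" "p0 \<in> E" "Cod Y c1 = Dom Y p0" "p0 \<cdot> c1 = c0"
    and lift: "right_lifting Y K p0"
    using corner_factorization[OF c0(1)] by blast
  have c1': "c1 \<in> Mor Y" "p0 \<in> Mor Y"
    using corner_Mor c1 by simp_all
  have dc: "Dom Y c1 = Dom Y fX" "Cod Y p0 = Dom Y p"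
    using c1 c1' c0 Dom_Comp[of c1 p0] Cod_Comp[of c1 p0] by simp_all
  let ?c = "Square fX (p \<cdot> p0) c1 (Idn Y (Cod Y fX))"
  let ?p = "Square (p \<cdot> p0) fY (q \<cdot> p0) b"
  have pp0: "p \<cdot> p0 \<in> E" "q \<cdot> p0 \<in> E"
    using Comp_ext[OF c1(2) pq(1)] Comp_ext[OF c1(2) pq(2)] dc PB by simp_all
  have "(p \<cdot> p0) \<cdot> c1 = fX"
    using c1 c1' dc PB c0 by (simp add: assoc)
  then have cK: "?c \<in> K'"
    using f PB c1 c1' dc pp0 by (simp add: corner_squares_def iso_Idn)
  have comm: "fY \<cdot> (q \<cdot> p0) = b \<cdot> (p \<cdot> p0)"
    using f PB c1' dc by (simp flip: assoc)
  have pE: "?p \<in> E'"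
    by (rule double_extensionsI[OF pp0(1) f(3) pp0(2) f(5) _ _ _ comm pb c1(2)])
      (use f PB c1' dc in simp_all)
  have "(q \<cdot> p0) \<cdot> c1 = t"
    using c1 c1' dc PB c0 by (simp add: assoc)
  then have "?p \<cdot>\<^bsub>Ext Y E\<^esub> ?c = f"
    using f by simp
  moreover have "right_lifting (Ext Y E) K' ?p"
    unfolding right_lifting_def
  proof (intro ballI impI)
    fix e x z
    assume exz: "e \<in> K'" "x \<in> Mor (Ext Y E)" "z \<in> Mor (Ext Y E)"
      "Dom (Ext Y E) x = Dom (Ext Y E) e \<and> Cod (Ext Y E) x = Dom (Ext Y E) ?p \<and>
       Dom (Ext Y E) z = Cod (Ext Y E) e \<and> Cod (Ext Y E) z = Cod (Ext Y E) ?p \<and>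
       ?p \<cdot>\<^bsub>Ext Y E\<^esub> x = z \<cdot>\<^bsub>Ext Y E\<^esub> e"
    from exz(1) obtain fU fV et eb k where e: "e = Square fU fV et eb" "et \<in> K" "iso Y eb"
      "fU \<in> E" "fV \<in> E" "et \<in> Mor Y" "Dom Y et = Dom Y fU" "Cod Y et = Dom Y fV" "eb \<in> Mor Y"
      "Dom Y eb = Cod Y fU" "Cod Y eb = Cod Y fV" "fV \<cdot> et = eb \<cdot> fU"
      and k: "k \<in> Mor Y" "Dom Y k = Cod Y fV" "Cod Y k = Cod Y fU"
      "k \<cdot> eb = Idn Y (Cod Y fU)" "eb \<cdot> k = Idn Y (Cod Y fV)"
      by (rule corner_squaresE)
    have ends: "sq_dom x = fU" "sq_cod x = p \<cdot> p0" "sq_dom z = fV" "sq_cod z = fY"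
      using exz(4)[THEN conjunct1] exz(4)[THEN conjunct2, THEN conjunct1]
        exz(4)[THEN conjunct2, THEN conjunct2, THEN conjunct1]
        exz(4)[THEN conjunct2, THEN conjunct2, THEN conjunct2, THEN conjunct1] e(1)
      by simp_all
    from exz(2) obtain xt xb where x: "x = Square fU (p \<cdot> p0) xt xb" "xt \<in> Mor Y" "xb \<in> Mor Y"
      "Dom Y xt = Dom Y fU" "Cod Y xt = Dom Y p0" "Dom Y xb = Cod Y fU" "Cod Y xb = Cod Y p"
      "(p \<cdot> p0) \<cdot> xt = xb \<cdot> fU"
      by (rule Mor_ExtE) (use ends(1,2) c1' dc PB in simp)
    from exz(3) obtain zt zb where z: "z = Square fV fY zt zb" "zt \<in> Mor Y" "zb \<in> Mor Y"
      "Dom Y zt = Dom Y fV" "Cod Y zt = Dom Y fY" "Dom Y zb = Cod Y fV" "Cod Y zb = Cod Y fY"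
      "fY \<cdot> zt = zb \<cdot> fV"
      by (rule Mor_ExtE) (use ends(3,4) in simp)
    have sq: "(q \<cdot> p0) \<cdot> xt = zt \<cdot> et" "b \<cdot> xb = zb \<cdot> eb"
      using exz(4)[THEN conjunct2, THEN conjunct2, THEN conjunct2, THEN conjunct2] e(1) x(1) z(1)
      by simp_all
    have db: "b \<cdot> (xb \<cdot> k) = zb"
      using sq(2) e x z k f PB by (simp add: absorb[OF sq(2)] assoc)
    have "b \<cdot> ((xb \<cdot> k) \<cdot> fV) = fY \<cdot> zt"
      using db e x z k f PB by (simp add: absorb[OF db])
    then obtain y where y: "y \<in> Mor Y" "Dom Y y = Dom Y fV" "Cod Y y = Dom Y p"
      "p \<cdot> y = (xb \<cdot> k) \<cdot> fV" "q \<cdot> y = zt"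
      by (rule pullback_lift[OF pb]) (use e x z k f PB in simp_all)
    have "p0 \<cdot> xt = y \<cdot> et"
    proof (rule pullback_joint_mono[OF pb])
      have "p \<cdot> (y \<cdot> et) = xb \<cdot> (k \<cdot> (fV \<cdot> et))"
        using absorb[OF y(4), of et] e x y k PB by (simp add: assoc)
      also have "\<dots> = xb \<cdot> fU"
        using absorb[OF k(4), of fU] e x k by simp
      finally show "p \<cdot> (p0 \<cdot> xt) = p \<cdot> (y \<cdot> et)"
        using x c1' dc PB by (simp flip: assoc)
      show "q \<cdot> (p0 \<cdot> xt) = q \<cdot> (y \<cdot> et)"
        using absorb[OF y(5), of et] sq(1) e x y c1' dc PB by (simp add: assoc)
    qed (use e x y c1' dc in simp_all)
    then obtain dt where dt: "dt \<in> Mor Y" "Dom Y dt = Cod Y et" "Cod Y dt = Dom Y p0"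
      "dt \<cdot> et = xt" "p0 \<cdot> dt = y"
      by (rule right_liftingE[OF lift e(2)]) (use e x y dc in simp_all)
    let ?d = "Square fV (p \<cdot> p0) dt (xb \<cdot> k)"
    have "(p \<cdot> p0) \<cdot> dt = (xb \<cdot> k) \<cdot> fV" "(q \<cdot> p0) \<cdot> dt = zt"
      using dt y c1' dc PB by (simp_all add: assoc)
    moreover have "(xb \<cdot> k) \<cdot> eb = xb"
      using e x k by (simp add: assoc)
    ultimately have "?d \<in> hom (Ext Y E) (Cod (Ext Y E) e) (Dom (Ext Y E) ?p) \<and>
        ?d \<cdot>\<^bsub>Ext Y E\<^esub> e = x \<and> ?p \<cdot>\<^bsub>Ext Y E\<^esub> ?d = z"
      using e x z k dt db pp0 c1' dc PB by (simp add: hom_def)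
    then show "\<exists>d \<in> hom (Ext Y E) (Cod (Ext Y E) e) (Dom (Ext Y E) ?p).
        d \<cdot>\<^bsub>Ext Y E\<^esub> e = x \<and> ?p \<cdot>\<^bsub>Ext Y E\<^esub> d = z"
      by blast
  qed
  ultimately show ?thesis
    using cK pE by (intro bexI[of _ ?c] bexI[of _ ?p]) auto
qed

text \<open>The bottom component of \<open>h\<close> is a split monomorphism as well as an extension, and
  so it is invertible.\<close>

lemma corner_cancel_square:
  assumes "h \<in> E'" "u \<in> Mor (Ext Y E)" "Cod (Ext Y E) h = Dom (Ext Y E) u"
    "u \<cdot>\<^bsub>Ext Y E\<^esub> h \<in> K'"
  shows "h \<in> K'"
proof -
  from assms(1) obtain fA fB ht hb where h: "h = Square fA fB ht hb" "ht \<in> E" "hb \<in> E"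
    "Cod Y ht = Dom Y fB" "Cod Y hb = Cod Y fB"
    by (rule double_extensionsE)
  from assms(2) obtain fC ut ub where u: "u = Square fB fC ut ub" "ut \<in> Mor Y" "ub \<in> Mor Y"
    "Dom Y ut = Dom Y fB" "Dom Y ub = Cod Y fB"
    by (rule Mor_ExtE) (use assms(3) h in simp)
  have "ut \<cdot> ht \<in> K" "iso Y (ub \<cdot> hb)"
    using assms(4) h u by (simp_all add: corner_squares_def)
  then have "ht \<in> K" "iso Y hb"
    using corner_cancel[OF h(2) u(2)] iso_cancel_epi[OF _ ext_epi[OF h(3)] u(3)] h u by simp_all
  then show ?thesis
    using double_extensions_Mor[OF assms(1)] h by (simp add: corner_squares_def)
qed

text \<open>Let \<open>c\<close> and \<open>d\<close> be the comparison maps of \<open>g \<cdot> q\<close> and \<open>g\<close>. By pasting, the map \<open>v\<close>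
  between the pullbacks is a pullback of the bottom of \<open>q\<close>, so \<open>v \<cdot> c\<close> is an extension.
  It equals \<open>d\<close> after the top of \<open>q\<close>, and \<open>d\<close> is an extension by cancellation one
  dimension lower.\<close>

lemma ext_cancel_square:
  assumes "q \<in> E'" "g \<in> Mor (Ext Y E)" "Cod (Ext Y E) q = Dom (Ext Y E) g"
    "g \<cdot>\<^bsub>Ext Y E\<^esub> q \<in> E'"
  shows "g \<in> E'"
proof -
  from assms(1) obtain fX fZ qt qb where q: "q = Square fX fZ qt qb" "fX \<in> E" "fZ \<in> E"
    "qt \<in> E" "qb \<in> E" "Dom Y qt = Dom Y fX" "Cod Y qt = Dom Y fZ" "Dom Y qb = Cod Y fX"
    "Cod Y qb = Cod Y fZ" "fZ \<cdot> qt = qb \<cdot> fX"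
    by (rule double_extensionsE)
  from assms(2) obtain fW gt gb where g: "g = Square fZ fW gt gb" "fW \<in> E" "gt \<in> Mor Y"
    "Dom Y gt = Dom Y fZ" "Cod Y gt = Dom Y fW" "gb \<in> Mor Y" "Dom Y gb = Cod Y fZ"
    "Cod Y gb = Cod Y fW" "fW \<cdot> gt = gb \<cdot> fZ"
    by (rule Mor_ExtE) (use assms(3) q(1) in simp)
  from assms(4) obtain p p' c where gq: "gt \<cdot> qt \<in> E" "gb \<cdot> qb \<in> E"
    and pb: "is_pullback Y (gb \<cdot> qb) fW p p'" and c: "c \<in> E" "Dom Y c = Dom Y fX"
    "Cod Y c = Dom Y p" "p \<cdot> c = fX" "p' \<cdot> c = gt \<cdot> qt"
    by (rule double_extensionsE) (use g(1) q(1) in simp)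
  note PB = is_pullbackD[OF pb]
  have gE: "gt \<in> E" "gb \<in> E"
    using ext_cancel[OF q(4) g(3)] ext_cancel[OF q(5) g(6)] gq q(7,9) g(4,7) by simp_all
  obtain a' a where "is_pullback Y fW gb a' a"
    using ex_pullback_ext[OF g(2,6)] g(8) by auto
  then have pb': "is_pullback Y gb fW a a'"
    by (rule pullback_sym)
  note PB' = is_pullbackD[OF pb']
  obtain d where d: "d \<in> Mor Y" "Dom Y d = Dom Y fZ" "Cod Y d = Dom Y a" "a \<cdot> d = fZ" "a' \<cdot> d = gt"
    by (rule pullback_lift[OF pb', of fZ gt]) (use g q(3) in simp_all)
  have "gb \<cdot> (qb \<cdot> p) = fW \<cdot> p'"
    using PB(3,7,9) q(5,8,9) g(6,7) by (simp add: assoc)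
  then obtain v where v: "v \<in> Mor Y" "Dom Y v = Dom Y p" "Cod Y v = Dom Y a" "a \<cdot> v = qb \<cdot> p"
    "a' \<cdot> v = p'"
    by (rule pullback_lift[OF pb']) (use PB g(6-8) q(5,8,9) in simp_all)
  have v': "Dom Y v = Dom Y p'" "Cod Y v = Dom Y a'" "a' \<cdot> v = Idn Y (Dom Y fW) \<cdot> p'"
    using v PB(4,6,8) PB'(6) by simp_all
  have "is_pullback Y qb a p v"
    by (rule pullback_comparison[OF pullback_sym[OF pb] pullback_sym[OF pb'] iso_Idn _ _ _ _ _ _
          v(1) v' v(4)]) (use g(2,7) q(5,9) in simp_all)
  then have "v \<in> E"
    using q(5) by (rule pullback_ext)
  then have "v \<cdot> c \<in> E"
    using Comp_ext[OF c(1)] c(3) v(2) by simp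
  moreover have "d \<cdot> qt = v \<cdot> c"
  proof (rule pullback_joint_mono[OF pb'])
    have "a \<cdot> (v \<cdot> c) = qb \<cdot> (p \<cdot> c)"
      using absorb[OF v(4), of c] PB(3,7) PB'(3) c(1,3) v(1-3) q(5,8,9) g(6,7)
      by (simp add: assoc)
    then show "a \<cdot> (d \<cdot> qt) = a \<cdot> (v \<cdot> c)"
      using absorb[OF d(4), of qt] PB'(3) c(4) d(1-3) q(4,7,10) by simp
    show "a' \<cdot> (d \<cdot> qt) = a' \<cdot> (v \<cdot> c)"
      using absorb[OF d(5), of qt] absorb[OF v(5), of c] PB'(4,6) c(1,3,5) d(1-3) v(1-3) q(4,7)
      by simp
  qed (use q(4,6,7) d(1-3) v(1-3) c(1-3) in simp_all)
  ultimately have "d \<in> E"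
    using ext_cancel[OF q(4) d(1)] q(7) d(2) by simp
  then show ?thesis
    unfolding g(1) using double_extensionsI[OF q(3) g(2) gE g(4,5,7,9) pb' _ d(2-5)] by simp
qed

text \<open>Pulling the codomain \<open>fD\<close> of \<open>r\<close> back along the bottom of \<open>r\<close> reduces the problem
  to one with trivial bottom, where the top is treated one dimension lower. This yields
  the corner \<open>q\<close> of the image, whose codomain becomes the domain of a new extension
  \<open>?fI\<close> by cancellation. The laborious part is that the induced map \<open>?t\<close> out of the
  codomain of \<open>h\<close> is a double extension. Its comparison map \<open>c\<close>, preceded by the top of
  \<open>h\<close>, equals \<open>v \<cdot> c0\<close>, where \<open>c0\<close> is the comparison map of \<open>\<alpha>\<close> and \<open>v\<close> is a pullback of
  \<open>q\<close>; so \<open>c\<close> is an extension, again by cancellation.\<close>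

lemma corner_image_square:
  assumes "\<alpha> \<in> E'" "h \<in> E'" "h \<in> K'" "r \<in> Mor (Ext Y E)" "s \<in> Mor (Ext Y E)"
    "Dom (Ext Y E) h = Dom (Ext Y E) \<alpha>" "Dom (Ext Y E) r = Cod (Ext Y E) \<alpha>"
    "Dom (Ext Y E) s = Cod (Ext Y E) h" "r \<cdot>\<^bsub>Ext Y E\<^esub> \<alpha> = s \<cdot>\<^bsub>Ext Y E\<^esub> h"
  shows "\<exists>q \<in> E' \<inter> K'. \<exists>i \<in> Mor (Ext Y E). \<exists>t \<in> E'.
    Dom (Ext Y E) q = Cod (Ext Y E) \<alpha> \<and> Dom (Ext Y E) i = Cod (Ext Y E) q \<and>
    Dom (Ext Y E) t = Cod (Ext Y E) h \<and> Cod (Ext Y E) t = Cod (Ext Y E) q \<and>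
    i \<cdot>\<^bsub>Ext Y E\<^esub> q = r \<and> t \<cdot>\<^bsub>Ext Y E\<^esub> h = q \<cdot>\<^bsub>Ext Y E\<^esub> \<alpha>"
proof -
  from assms(1) obtain fA fB at ab p q0 c0 where \<alpha>: "\<alpha> = Square fA fB at ab" "fA \<in> E" "fB \<in> E"
    "at \<in> E" "ab \<in> E" "Dom Y at = Dom Y fA" "Cod Y at = Dom Y fB" "Dom Y ab = Cod Y fA"
    "Cod Y ab = Cod Y fB" "fB \<cdot> at = ab \<cdot> fA" and pb: "is_pullback Y ab fB p q0"
    and c0: "c0 \<in> E" "Dom Y c0 = Dom Y fA" "Cod Y c0 = Dom Y p" "p \<cdot> c0 = fA" "q0 \<cdot> c0 = at"
    by (rule double_extensionsE)
  note PB = is_pullbackD[OF pb]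
  from assms(3) obtain fH ht hb k where h: "h = Square fA fH ht hb" "ht \<in> K" "iso Y hb"
    "fH \<in> E" "ht \<in> Mor Y" "Dom Y ht = Dom Y fA" "Cod Y ht = Dom Y fH" "hb \<in> Mor Y"
    "Dom Y hb = Cod Y fA" "Cod Y hb = Cod Y fH" "fH \<cdot> ht = hb \<cdot> fA"
    and k: "k \<in> Mor Y" "Dom Y k = Cod Y fH" "Cod Y k = Cod Y fA"
    "k \<cdot> hb = Idn Y (Cod Y fA)" "hb \<cdot> k = Idn Y (Cod Y fH)"
    by (rule corner_squaresE) (use assms(6) \<alpha>(1) in simp)
  have htE: "ht \<in> E"
    using assms(2) by (rule double_extensionsE) (use h in simp)
  from assms(4) obtain fD rt rb where r: "r = Square fB fD rt rb" "fD \<in> E" "rt \<in> Mor Y"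
    "Dom Y rt = Dom Y fB" "Cod Y rt = Dom Y fD" "rb \<in> Mor Y" "Dom Y rb = Cod Y fB"
    "Cod Y rb = Cod Y fD" "fD \<cdot> rt = rb \<cdot> fB"
    by (rule Mor_ExtE) (use assms(7) \<alpha>(1) in simp)
  from assms(5) obtain st sb where s: "s = Square fH fD st sb" "st \<in> Mor Y"
    "Dom Y st = Dom Y fH" "Cod Y st = Dom Y fD" "sb \<in> Mor Y" "Dom Y sb = Cod Y fH"
    "Cod Y sb = Cod Y fD" "fD \<cdot> st = sb \<cdot> fH"
    by (rule Mor_ExtE) (use assms(8,9) h(1) r(1) in simp)
  have sq: "rt \<cdot> at = st \<cdot> ht" "rb \<cdot> ab = sb \<cdot> hb"
    using assms(9) \<alpha>(1) h(1) r(1) s(1) by simp_all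
  \<comment> \<open>The bottom of the quotient map out of the codomain of \<open>h\<close>, forced by \<open>t \<cdot> h = q \<cdot> \<alpha>\<close> as the
      bottom of the corner square \<open>q\<close> will be an identity.\<close>
  define j where "j = ab \<cdot> k"
  have j: "j \<in> Mor Y" "Dom Y j = Cod Y fH" "Cod Y j = Cod Y fB"
    using \<alpha> k by (simp_all add: j_def)
  have jhb: "j \<cdot> hb = ab"
    using \<alpha> h k by (simp add: j_def assoc)
  have "k \<in> E"
    by (rule iso_ext[OF isoI[of k hb]]) (use h k in simp_all)
  then have jE: "j \<in> E"
    unfolding j_def using Comp_ext \<alpha> k by simp
  have rbj: "rb \<cdot> j = sb"
    using absorb[OF sq(2), of k] \<alpha> h r s k by (simp add: j_def assoc)
  obtain p1 p2 where pbD: "is_pullback Y fD rb p1 p2"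
    using ex_pullback_ext[OF r(2,6)] r by auto
  note PD = is_pullbackD[OF pbD]
  obtain r' where r': "r' \<in> Mor Y" "Dom Y r' = Dom Y rt" "Cod Y r' = Dom Y p1" "p1 \<cdot> r' = rt"
    "p2 \<cdot> r' = fB"
    by (rule pullback_lift[OF pbD r(9)]) (use r \<alpha> in simp_all)
  have "fD \<cdot> st = rb \<cdot> (j \<cdot> fH)"
    using s r j h by (simp add: absorb[OF rbj])
  then obtain s' where s': "s' \<in> Mor Y" "Dom Y s' = Dom Y st" "Cod Y s' = Dom Y p1"
    "p1 \<cdot> s' = st" "p2 \<cdot> s' = j \<cdot> fH"
    by (rule pullback_lift[OF pbD]) (use r s j h in simp_all)
  have jfH: "j \<cdot> (fH \<cdot> ht) = ab \<cdot> fA"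
    using absorb[OF jhb, of fA] \<alpha> h j by simp
  have "r' \<cdot> at = s' \<cdot> ht"
  proof (rule pullback_joint_mono[OF pbD])
    show "p1 \<cdot> (r' \<cdot> at) = p1 \<cdot> (s' \<cdot> ht)"
      using absorb[OF r'(4), of at] absorb[OF s'(4), of ht] sq r r' s s' \<alpha> h PD by simp
    show "p2 \<cdot> (r' \<cdot> at) = p2 \<cdot> (s' \<cdot> ht)"
      using absorb[OF r'(5), of at] absorb[OF s'(5), of ht] jfH r r' s s' \<alpha> h j PD
      by (simp add: assoc)
  qed (use r r' s s' \<alpha> h in simp_all)
  then obtain q i t where q: "q \<in> E" "q \<in> K" "i \<in> Mor Y" "t \<in> E" "Dom Y q = Dom Y fB"
    "Dom Y i = Cod Y q" "Dom Y t = Dom Y fH" "Cod Y t = Cod Y q" "i \<cdot> q = r'" "t \<cdot> ht = q \<cdot> at"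
    using corner_image[OF \<alpha>(4) htE h(2) r'(1) s'(1)] h \<alpha> r r' s s' by auto
  have codi: "Cod Y i = Dom Y p1"
    using Cod_Comp[of q i] q r' by simp
  let ?fI = "p2 \<cdot> i"
  have fIq: "?fI \<cdot> q = fB"
    using q r' PD codi by (simp add: assoc)
  have fIE: "?fI \<in> E"
    using ext_cancel[OF q(1), of ?fI] fIq q PD codi \<alpha>(3) by simp
  have fI: "?fI \<in> Mor Y" "Dom Y ?fI = Cod Y q" "Cod Y ?fI = Cod Y fB"
    using q PD codi r by simp_all
  let ?q = "Square fB ?fI q (Idn Y (Cod Y fB))"
  have qE: "?q \<in> E'"
    by (rule double_extension_iso_bottom) (use \<alpha> q fI fIE fIq iso_Idn in simp_all)
  have qK: "?q \<in> K'"
    using \<alpha> q fI fIE fIq iso_Idn by (simp add: corner_squares_def)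
  let ?i = "Square ?fI fD (p1 \<cdot> i) rb"
  have "fD \<cdot> (p1 \<cdot> i) = rb \<cdot> (p2 \<cdot> i)"
    using absorb[OF PD(9), of i] PD(1-8) q(3) codi by (simp add: assoc)
  then have iM: "?i \<in> Mor (Ext Y E)"
    using r(2-8) q(3,6) codi PD(1-8) fI fIE by simp
  have "(p1 \<cdot> i) \<cdot> q = rt"
    using q(1,3,6,9) codi PD(3,7) r'(4) by (simp add: assoc)
  then have iq: "?i \<cdot>\<^bsub>Ext Y E\<^esub> ?q = r"
    using r(1,6,7) by simp
  have fIt: "?fI \<cdot> t = j \<cdot> fH"
  proof (rule epiD[OF ext_epi[OF htE]])
    show "(?fI \<cdot> t) \<cdot> ht = (j \<cdot> fH) \<cdot> ht"
      using fI q h j jfH \<alpha> absorb[OF fIq, of at] by (simp add: assoc del: Comp_Mor)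
  qed (use fI q h j in simp_all)
  obtain a b where "is_pullback Y ?fI j a b"
    using ex_pullback_ext[OF fIE j(1)] fI j by auto
  then have pbI: "is_pullback Y j ?fI b a"
    by (rule pullback_sym)
  note PI = is_pullbackD[OF pbI]
  obtain c where c: "c \<in> Mor Y" "Dom Y c = Dom Y fH" "Cod Y c = Dom Y b" "b \<cdot> c = fH" "a \<cdot> c = t"
    by (rule pullback_lift[OF pbI fIt[symmetric]]) (use h j q fI in simp_all)
  have "j \<cdot> (hb \<cdot> p) = ?fI \<cdot> (q \<cdot> q0)"
    using absorb[OF jhb, of p] absorb[OF fIq, of q0] PB fI q h j \<alpha> by simp
  then obtain v where v: "v \<in> Mor Y" "Dom Y v = Dom Y p" "Cod Y v = Dom Y b"
    "b \<cdot> v = hb \<cdot> p" "a \<cdot> v = q \<cdot> q0"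
    by (rule pullback_lift[OF pbI]) (use PB fI q h j \<alpha> in simp_all)
  have pbv: "is_pullback Y q a q0 v"
    by (rule pullback_comparison[OF pb pbI h(3) _ _ jhb _ _ fIq v]) (use h \<alpha> j q fI in simp_all)
  have "v \<in> E"
    by (rule pullback_ext[OF pbv q(1)])
  then have "v \<cdot> c0 \<in> E"
    using Comp_ext[OF c0(1)] c0 v by simp
  moreover have "c \<cdot> ht = v \<cdot> c0"
  proof (rule pullback_joint_mono[OF pbI])
    show "b \<cdot> (c \<cdot> ht) = b \<cdot> (v \<cdot> c0)"
      using absorb[OF c(4), of ht] absorb[OF v(4), of c0] c c0 v h PB PI \<alpha> by (simp add: assoc)
    show "a \<cdot> (c \<cdot> ht) = a \<cdot> (v \<cdot> c0)"
      using absorb[OF c(5), of ht] absorb[OF v(5), of c0] c c0 v h q PB PI \<alpha> fI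
      by (simp add: assoc)
  qed (use c c0 v h in simp_all)
  ultimately have cE: "c \<in> E"
    using ext_cancel[OF htE c(1)] c h by simp
  let ?t = "Square fH ?fI t j"
  have tE: "?t \<in> E'"
    by (rule double_extensionsI[OF h(4) fIE q(4) jE _ _ _ fIt pbI cE]) (use q fI j c in simp_all)
  have "?t \<cdot>\<^bsub>Ext Y E\<^esub> h = ?q \<cdot>\<^bsub>Ext Y E\<^esub> \<alpha>"
    using \<alpha> h q jhb by simp
  then show ?thesis
    using qE qK iM tE iq \<alpha>(1) h(1) by (intro bexI[of _ ?q] bexI[of _ ?i] bexI[of _ ?t]) auto
qed

theorem corner_class_squares: "corner_class (Ext Y E) E' K'"
proof
  show "c \<in> Mor (Ext Y E)" if "c \<in> K'" for c
    using that by (simp add: corner_squares_def)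
qed (fact corner_factorization_square corner_cancel_square ext_cancel_square
    corner_image_square)+

end

section \<open>Reflective subcategories\<close>

lemma pushout_factor:
  assumes "is_pushout Y f g p q" "r \<cdot>\<^bsub>Y\<^esub> f = s \<cdot>\<^bsub>Y\<^esub> g"
    "r \<in> Mor Y" "s \<in> Mor Y" "Cod Y r = Cod Y s" "Dom Y r = Cod Y f" "Dom Y s = Cod Y g"
  obtains w where "w \<in> Mor Y" "Dom Y w = Cod Y p" "Cod Y w = Cod Y r"
    "w \<cdot>\<^bsub>Y\<^esub> p = r" "w \<cdot>\<^bsub>Y\<^esub> q = s"
proof -
  have "\<exists>!w. w \<in> hom Y (Cod Y p) (Cod Y r) \<and> w \<cdot>\<^bsub>Y\<^esub> p = r \<and> w \<cdot>\<^bsub>Y\<^esub> q = s"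
    using assms unfolding is_pushout_def by blast
  then show thesis
    using that unfolding hom_def by blast
qed

context ext_reflective
begin

lemma category_Y: "category Y"
  using full_replete by (simp add: full_replete_subcategory_def)

lemma X_subcategory:
  shows Ob_X: "a \<in> Ob X \<Longrightarrow> a \<in> Ob Y"
    and Mor_X: "f \<in> Mor X \<longleftrightarrow> f \<in> Mor Y \<and> Dom Y f \<in> Ob X \<and> Cod Y f \<in> Ob X"
    and Dom_X: "Dom X = Dom Y"
    and Cod_X: "Cod X = Cod Y"
proof -
  have sub: "Ob X \<subseteq> Ob Y" and X: "X = full_subcategory Y (Ob X)"
    using full_replete unfolding full_replete_subcategory_def by blast+
  show "a \<in> Ob X \<Longrightarrow> a \<in> Ob Y"
    using sub by blast
  show "f \<in> Mor X \<longleftrightarrow> f \<in> Mor Y \<and> Dom Y f \<in> Ob X \<and> Cod Y f \<in> Ob X"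
    using arg_cong[OF X, of Mor] by (simp add: full_subcategory_def)
  show "Dom X = Dom Y"
    using arg_cong[OF X, of Dom] by (simp add: full_subcategory_def)
  show "Cod X = Cod Y"
    using arg_cong[OF X, of Cod] by (simp add: full_subcategory_def)
qed

lemma iso_closed: "\<lbrakk>iso Y f; Dom Y f \<in> Ob X\<rbrakk> \<Longrightarrow> Cod Y f \<in> Ob X"
  using full_replete unfolding full_replete_subcategory_def by blast

lemma unit_props:
  assumes "a \<in> Ob Y"
  shows "\<eta> a \<in> Mor Y" "Dom Y (\<eta> a) = a" "Cod Y (\<eta> a) = Fob L a" "Fob L a \<in> Ob X"
  using unit.component_hom[OF assms] L.Fob_closed[OF assms]
  by (simp_all add: hom_def func_id_def func_comp_def)

lemma reflector_props:
  assumes "f \<in> Mor Y"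
  shows "Fmor L f \<in> Mor Y" "Dom Y (Fmor L f) = Fob L (Dom Y f)"
    "Cod Y (Fmor L f) = Fob L (Cod Y f)"
  using L.Fmor_hom[of f "Dom Y f" "Cod Y f"] assms by (simp_all add: hom_def Mor_X Dom_X Cod_X)

lemma unit_naturality:
  assumes "f \<in> Mor Y"
  shows "\<eta> (Cod Y f) \<cdot>\<^bsub>Y\<^esub> f = Fmor L f \<cdot>\<^bsub>Y\<^esub> \<eta> (Dom Y f)"
  using unit.naturality[of f "Dom Y f" "Cod Y f"] assms
  by (simp add: hom_def func_id_def func_comp_def)

lemma counit_props:
  assumes "b \<in> Ob X"
  shows "\<epsilon> b \<in> Mor Y" "Dom Y (\<epsilon> b) = Fob L b" "Cod Y (\<epsilon> b) = b"
    "\<epsilon> b \<cdot>\<^bsub>Y\<^esub> \<eta> b = Idn Y b"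
  using counit.component_hom[OF assms] triangle_R[OF assms]
  by (simp_all add: hom_def func_id_def func_comp_def Mor_X Dom_X Cod_X)

lemma unit_universal:
  assumes "g \<in> Mor Y" "Cod Y g \<in> Ob X"
  obtains u where "u \<in> Mor Y" "Dom Y u = Cod Y (\<eta> (Dom Y g))" "Cod Y u = Cod Y g"
    "u \<cdot>\<^bsub>Y\<^esub> \<eta> (Dom Y g) = g"
proof -
  let ?b = "Cod Y g"
  note eps = counit_props[OF assms(2)] and Lg = reflector_props[OF assms(1)]
    and ea = unit_props[OF unit.F.A.Dom_closed[OF assms(1)]]
    and eb = unit_props[OF unit.F.A.Cod_closed[OF assms(1)]]
  have "(\<epsilon> ?b \<cdot>\<^bsub>Y\<^esub> Fmor L g) \<cdot>\<^bsub>Y\<^esub> \<eta> (Dom Y g) = \<epsilon> ?b \<cdot>\<^bsub>Y\<^esub> (\<eta> ?b \<cdot>\<^bsub>Y\<^esub> g)"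
    using eps Lg ea unit_naturality[OF assms(1)] by (simp add: unit.F.A.assoc)
  also have "\<dots> = g"
    using eps eb assms by (simp add: unit.F.A.absorb[OF eps(4)])
  finally show thesis
    using that[of "\<epsilon> ?b \<cdot>\<^bsub>Y\<^esub> Fmor L g"] eps Lg ea by simp
qed

lemma unit_iso:
  assumes "a \<in> Ob X" "epi Y (\<eta> a)"
  shows "iso Y (\<eta> a)"
  using category.split_mono_epi_iso[OF category_Y assms(2) counit_props(1)[OF assms(1)]]
    counit_props[OF assms(1)] unit_props[OF Ob_X[OF assms(1)]] by simp

text \<open>When \<open>\<eta>\<close> is invertible at the domain of \<open>f\<close>, the identity and \<open>f\<close> after that
  inverse form a cocone, and the induced map out of the pushout is a retraction of the
  unit at the codomain.\<close>

lemma birkhoff_imp_closed_under_quotients: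
  assumes epi: "\<And>f. f \<in> E \<Longrightarrow> epi Y f"
    and "birkhoff Y L \<eta> E"
  shows "closed_under_quotients Y X E"
  unfolding closed_under_quotients_def
proof (intro ballI impI)
  fix f assume f: "f \<in> E" and A: "Dom Y f \<in> Ob X"
  have fM: "f \<in> Mor Y"
    using epi[OF f] by (simp add: epi_def)
  note ua = unit_props[OF unit.F.A.Dom_closed[OF fM]] and ub = unit_props[OF unit.F.A.Cod_closed[OF fM]]
  have po: "is_pushout Y f (\<eta> (Dom Y f)) (\<eta> (Cod Y f)) (Fmor L f)"
    using assms(2) f by (simp add: birkhoff_def)
  have "iso Y (\<eta> (Dom Y f))"
    using unit_iso[OF A] epi unit_ext unit.F.A.Dom_closed[OF fM] by blast
  then obtain k where k: "k \<in> Mor Y" "Dom Y k = Cod Y (\<eta> (Dom Y f))"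
    "Cod Y k = Dom Y (\<eta> (Dom Y f))" "k \<cdot>\<^bsub>Y\<^esub> \<eta> (Dom Y f) = Idn Y (Dom Y (\<eta> (Dom Y f)))"
    by (rule unit.F.A.isoE)
  have eq: "Idn Y (Cod Y f) \<cdot>\<^bsub>Y\<^esub> f = (f \<cdot>\<^bsub>Y\<^esub> k) \<cdot>\<^bsub>Y\<^esub> \<eta> (Dom Y f)"
    using fM k ua by (simp add: unit.F.A.assoc)
  obtain w where "w \<in> Mor Y" "Dom Y w = Cod Y (\<eta> (Cod Y f))"
    "w \<cdot>\<^bsub>Y\<^esub> \<eta> (Cod Y f) = Idn Y (Cod Y f)"
    by (rule pushout_factor[OF po eq]) (use fM k ua in simp_all)
  then have "iso Y (\<eta> (Cod Y f))"
    using unit.F.A.split_mono_epi_iso[OF epi[OF unit_ext]] fM ub by simp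
  then obtain l where l: "l \<in> Mor Y" "Dom Y l = Fob L (Cod Y f)" "Cod Y l = Cod Y f"
    "l \<cdot>\<^bsub>Y\<^esub> \<eta> (Cod Y f) = Idn Y (Cod Y f)" "\<eta> (Cod Y f) \<cdot>\<^bsub>Y\<^esub> l = Idn Y (Fob L (Cod Y f))"
    by (rule unit.F.A.isoE) (use ub in simp)
  have "iso Y l"
    by (rule unit.F.A.isoI[OF l(1) ub(1)]) (use l ub in simp_all)
  then show "Cod Y f \<in> Ob X"
    using iso_closed[of l] l ub by simp
qed

text \<open>As the units are epic, uniqueness and one of the two triangles of the pushout
  property are automatic, and only the factorization of \<open>r\<close> through the unit at the
  codomain has to be found.\<close>

lemma closed_under_quotients_imp_birkhoff:
  assumes epi: "\<And>f. f \<in> E \<Longrightarrow> epi Y f"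
    and "corner_class Y E K" and unit_corner: "\<And>a. a \<in> Ob Y \<Longrightarrow> \<eta> a \<in> K"
    and "closed_under_quotients Y X E"
  shows "birkhoff Y L \<eta> E"
  unfolding birkhoff_def
proof
  interpret corner_class Y E K
    by fact
  fix f assume f: "f \<in> E"
  have fM: "f \<in> Mor Y"
    using epi[OF f] by (simp add: epi_def)
  let ?a = "Dom Y f" and ?b = "Cod Y f"
  have ab: "?a \<in> Ob Y" "?b \<in> Ob Y"
    using fM by simp_all
  note ua = unit_props[OF ab(1)] and ub = unit_props[OF ab(2)] and Lf = reflector_props[OF fM]
    and nat = unit_naturality[OF fM]
  have epi_a: "epi Y (\<eta> ?a)" and epi_b: "epi Y (\<eta> ?b)"
    using epi unit_ext ab by blast+
  show "is_pushout Y f (\<eta> ?a) (\<eta> ?b) (Fmor L f)"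
    unfolding is_pushout_def
  proof (intro conjI ballI impI)
    fix r s
    assume "r \<in> Mor Y" "s \<in> Mor Y"
      "Cod Y r = Cod Y s \<and> Dom Y r = Cod Y f \<and> Dom Y s = Cod Y (\<eta> ?a) \<and>
       r \<cdot>\<^bsub>Y\<^esub> f = s \<cdot>\<^bsub>Y\<^esub> \<eta> ?a"
    then have rs: "r \<in> Mor Y" "s \<in> Mor Y" "Cod Y r = Cod Y s" "Dom Y r = ?b"
      "Dom Y s = Cod Y (\<eta> ?a)" and eq: "r \<cdot>\<^bsub>Y\<^esub> f = s \<cdot>\<^bsub>Y\<^esub> \<eta> ?a"
      by blast+
    obtain q i t where q: "q \<in> E" "i \<in> Mor Y" "t \<in> E" "Dom Y q = ?b" "Dom Y i = Cod Y q"
      "Dom Y t = Cod Y (\<eta> ?a)" "Cod Y t = Cod Y q" "i \<cdot>\<^bsub>Y\<^esub> q = r"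
      using corner_image[OF f unit_ext[OF ab(1)] unit_corner[OF ab(1)] rs(1,2) ua(2) rs(4,5) eq]
      by blast
    have qM: "q \<in> Mor Y"
      using epi[OF q(1)] by (simp add: epi_def)
    \<comment> \<open>The codomain of \<open>q\<close> is a quotient of the reflection of \<open>?a\<close> along \<open>t\<close>.\<close>
    have "Cod Y q \<in> Ob X"
      using assms(4) q(3,6,7) ua(3,4) unfolding closed_under_quotients_def by metis
    then obtain u where u: "u \<in> Mor Y" "Dom Y u = Cod Y (\<eta> ?b)" "Cod Y u = Cod Y q"
      "u \<cdot>\<^bsub>Y\<^esub> \<eta> ?b = q"
      using unit_universal[OF qM] unfolding q(4) by blast
    let ?w = "i \<cdot>\<^bsub>Y\<^esub> u"
    have w: "?w \<in> Mor Y" "Dom Y ?w = Cod Y (\<eta> ?b)" "Cod Y ?w = Cod Y r"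
      using u q(2,5,8) qM by (simp_all flip: q(8))
    have wb: "?w \<cdot>\<^bsub>Y\<^esub> \<eta> ?b = r"
      using u q(2,5,8) ub by (simp add: unit.F.A.assoc)
    have "(?w \<cdot>\<^bsub>Y\<^esub> Fmor L f) \<cdot>\<^bsub>Y\<^esub> \<eta> ?a = ?w \<cdot>\<^bsub>Y\<^esub> (\<eta> ?b \<cdot>\<^bsub>Y\<^esub> f)"
      unfolding nat by (rule unit.F.A.assoc) (use w Lf ua ub in simp_all)
    also have "\<dots> = s \<cdot>\<^bsub>Y\<^esub> \<eta> ?a"
      using unit.F.A.absorb[OF wb, of f] w ub fM eq by simp
    finally have "?w \<cdot>\<^bsub>Y\<^esub> Fmor L f = s"
      by (rule epiD[OF epi_a]) (use w Lf rs ua ub in simp_all)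
    then show "\<exists>!w. w \<in> hom Y (Cod Y (\<eta> ?b)) (Cod Y r) \<and> w \<cdot>\<^bsub>Y\<^esub> \<eta> ?b = r \<and>
        w \<cdot>\<^bsub>Y\<^esub> Fmor L f = s"
    proof (intro ex1I[of _ ?w] conjI)
      show "?w \<in> hom Y (Cod Y (\<eta> ?b)) (Cod Y r)"
        using w by (simp add: hom_def)
      fix x assume "x \<in> hom Y (Cod Y (\<eta> ?b)) (Cod Y r) \<and> x \<cdot>\<^bsub>Y\<^esub> \<eta> ?b = r \<and>
        x \<cdot>\<^bsub>Y\<^esub> Fmor L f = s"
      then have x: "x \<in> Mor Y" "Dom Y x = Cod Y (\<eta> ?b)" "x \<cdot>\<^bsub>Y\<^esub> \<eta> ?b = ?w \<cdot>\<^bsub>Y\<^esub> \<eta> ?b"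
        unfolding wb hom_def by blast+
      show "x = ?w"
        by (rule epiD[OF epi_b x(3,1) w(1) x(2) w(2)])
    qed (use wb in simp_all)
  qed (use fM ua ub Lf nat in simp_all)
qed

end

section \<open>Units are corner morphisms\<close>

lemma (in category) trivial_covering_imp_covering:
  assumes "trivial_covering C L \<eta> E c" "c \<in> Mor C" "Idn C (Cod C c) \<in> E"
  shows "covering C L \<eta> E c"
proof -
  have "is_pullback C (Idn C (Cod C c)) c (Idn C (Cod C c) \<cdot> c) (Idn C (Dom C c))"
    by (rule pullback_along_iso) (use assms(2) iso_Idn in simp_all)
  then have "is_pullback C (Idn C (Cod C c)) c c (Idn C (Dom C c))"
    using assms(2) by simp
  then show ?thesis
    using assms unfolding covering_def trivial_covering_def by blast
qed

text \<open>By the strong Birkhoff condition the comparison map \<open>c\<close> of the reflection square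
  of \<open>p\<close> is an extension. Composed with a projection it is the unit, a corner morphism,
  so that \<open>c\<close> is a corner morphism too. The lifting property of \<open>p\<close> gives a retraction
  of \<open>c\<close>; as \<open>c\<close> is epic, it is invertible, and the reflection square is a pullback.\<close>

lemma (in galois_structure) right_lifting_imp_trivial_covering:
  assumes "corner_class Y E K" and "strongly_birkhoff Y L \<eta> E"
    and unit_corner: "\<And>a. a \<in> Ob Y \<Longrightarrow> \<eta> a \<in> K"
    and p: "p \<in> E" "right_lifting Y K p"
  shows "trivial_covering Y L \<eta> E p"
proof -
  interpret Y: extension_category Y E
    by (rule extension_category)
  interpret corner_class Y E K
    by fact
  have pM: "p \<in> Mor Y"
    using p(1) by simp
  note ua = unit_props[OF unit.F.A.Dom_closed[OF pM]]
  have "double_extension Y E p (Fmor L p) (\<eta> (Dom Y p)) (\<eta> (Cod Y p))"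
    using assms(2) p(1) by (simp add: strongly_birkhoff_def)
  then obtain a b c where pb: "is_pullback Y (\<eta> (Cod Y p)) (Fmor L p) a b"
    and c: "c \<in> E" "c \<in> Mor Y" "Dom Y c = Dom Y p" "Cod Y c = Dom Y a"
      "a \<cdot>\<^bsub>Y\<^esub> c = p" "b \<cdot>\<^bsub>Y\<^esub> c = \<eta> (Dom Y p)"
    unfolding double_extension_def hom_def by blast
  note PB = is_pullbackD[OF pb]
  have "c \<in> K"
    using corner_cancel[OF c(1) PB(4)] unit_corner[OF unit.F.A.Dom_closed[OF pM]] c PB(6) by simp
  have Cod_a: "Cod Y a = Cod Y p"
    using unit.F.A.Cod_Comp[OF c(2) PB(3) c(4)] c(5) by simp
  obtain d where d: "d \<in> Mor Y" "Dom Y d = Cod Y c" "d \<cdot>\<^bsub>Y\<^esub> c = Idn Y (Dom Y p)"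
    by (rule right_liftingE[OF p(2) \<open>c \<in> K\<close>, of "Idn Y (Dom Y p)" a])
      (use pM c PB Cod_a in simp_all)
  have "iso Y c"
    using unit.F.A.split_mono_epi_iso[OF Y.ext_epi[OF c(1)] d(1,2)] d(3) c(3) by simp
  then have "is_pullback Y (\<eta> (Cod Y p)) (Fmor L p) p (\<eta> (Dom Y p))"
    using unit.F.A.pullback_precompose_iso[OF pb _ c(4)] c(5,6) by simp
  then show ?thesis
    using p(1) by (simp add: trivial_covering_def)
qed

text \<open>The covering \<open>p\<close> obtained from \<open>f\<close> is the target of a corner square \<open>?g\<close> out of
  \<open>f\<close>. This square factors through the unit at \<open>f\<close>, which is therefore a corner square
  by cancellation.\<close>

lemma unit_corner_squares:
  assumes "galois_structure Y X L \<eta> \<epsilon> E" and "strongly_birkhoff Y L \<eta> E"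
    and "corner_class Y E K" and "\<And>a. a \<in> Ob Y \<Longrightarrow> \<eta> a \<in> K"
    and "ext_reflective (Ext Y E) (Cov Y L \<eta> E) L' \<eta>' \<epsilon>' (double_extensions Y E)"
    and f: "f \<in> Ob (Ext Y E)"
  shows "\<eta>' f \<in> corner_squares Y E K"
proof -
  interpret corner_cells Y E K
    using assms(3) galois_structure.extension_category[OF assms(1)]
    by (simp add: corner_cells_def extension_cells_def)
  interpret \<Gamma>: galois_structure Y X L \<eta> \<epsilon> E
    by fact
  interpret R: ext_reflective "Ext Y E" "Cov Y L \<eta> E" L' \<eta>' \<epsilon>' E'
    by fact
  have fE: "f \<in> E"
    using f by simp
  then obtain c p where c: "c \<in> K" "p \<in> E" "Cod Y c = Dom Y p" "p \<cdot>\<^bsub>Y\<^esub> c = f"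
    and lift: "right_lifting Y K p"
    using corner_factorization by blast
  have M: "c \<in> Mor Y" "p \<in> Mor Y" "f \<in> Mor Y"
    using corner_Mor c fE by simp_all
  have df: "Dom Y c = Dom Y f" "Cod Y p = Cod Y f"
    using Dom_Comp[OF M(1,2)] Cod_Comp[OF M(1,2)] c by simp_all
  have "covering Y L \<eta> E p"
    using \<Gamma>.right_lifting_imp_trivial_covering[OF assms(3,2,4) c(2) lift]
    by (rule trivial_covering_imp_covering) (use M iso_ext iso_Idn in simp_all)
  then have P: "p \<in> Ob (Cov Y L \<eta> E)"
    using c M by (simp add: Cov_def full_subcategory_def)
  let ?g = "Square f p c (Idn Y (Cod Y f))"
  have g: "?g \<in> Mor (Ext Y E)"
    using c M fE df by simp
  obtain u where u: "u \<in> Mor (Ext Y E)" "Dom (Ext Y E) u = Cod (Ext Y E) (\<eta>' f)"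
    "u \<cdot>\<^bsub>Ext Y E\<^esub> \<eta>' f = ?g"
    using R.unit_universal[OF g] P by auto
  have "?g \<in> K'"
    using g c M iso_Idn by (simp add: corner_squares_def)
  then show ?thesis
    using corner_cancel_square[OF R.unit_ext[OF f] u(1)] u by simp
qed

section \<open>The tower of higher extensions\<close>

text \<open>The morphisms of \<open>k\<close>-fold extensions that are invertible at every vertex of their
  \<open>k\<close>-cubes except the initial one.\<close>

primrec corners :: "('o, 'm) category \<Rightarrow> nat \<Rightarrow> ('o, 'm) cell set" where
  "corners C 0 = Mor (base_category C)"
| "corners C (Suc k) = corner_squares (ext_category C k) (ext_class C (k + 1)) (corners C k)"

lemma ext_tower_simps:
  "ext_category C 0 = base_category C"
  "ext_class C (Suc 0) = {f. regular_epi (base_category C) f}"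
  "ext_category C (Suc k) = Ext (ext_category C k) (ext_class C (Suc k))"
  "ext_class C (Suc (Suc k)) = double_extensions (ext_category C k) (ext_class C (Suc k))"
  by (simp_all add: ext_category_def ext_class_def case_prod_beta)

theorem proposition4p3:
  fixes C :: "('o, 'm) category"
    and n :: nat
    and B :: "nat \<Rightarrow> ('o, 'm) cell_category"
    and F :: "nat \<Rightarrow> (('o, 'm) cell, ('o, 'm) cell, ('o, 'm) cell, ('o, 'm) cell) func"
    and \<eta> :: "nat \<Rightarrow> ('o, 'm) cell \<Rightarrow> ('o, 'm) cell"
    and \<epsilon> :: "nat \<Rightarrow> ('o, 'm) cell \<Rightarrow> ('o, 'm) cell"
  assumes "barr_exact_category C"
    and "n \<ge> 1"
    and "\<And>k. k \<le> n \<Longrightarrow>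
      galois_structure (ext_category C k) (B k) (F k) (\<eta> k) (\<epsilon> k) (ext_class C (k + 1))"
    and "\<And>k. k \<le> n \<Longrightarrow>
      strongly_birkhoff (ext_category C k) (F k) (\<eta> k) (ext_class C (k + 1))"
    and "\<And>k. 1 \<le> k \<Longrightarrow> k \<le> n \<Longrightarrow>
      B k = Cov (ext_category C (k - 1)) (F (k - 1)) (\<eta> (k - 1)) (ext_class C k)"
    and "B (n + 1) = Cov (ext_category C n) (F n) (\<eta> n) (ext_class C (n + 1))"
    and "ext_reflective (ext_category C (n + 1)) (B (n + 1)) (F (n + 1)) (\<eta> (n + 1)) (\<epsilon> (n + 1))
      (ext_class C (n + 2))"
  shows "birkhoff (ext_category C (n + 1)) (F (n + 1)) (\<eta> (n + 1)) (ext_class C (n + 2)) \<longleftrightarrow>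
    closed_under_quotients (ext_category C (n + 1)) (B (n + 1)) (ext_class C (n + 2))"
proof -
  let ?Y = "ext_category C" and ?E = "\<lambda>k. ext_class C (k + 1)"
  have galois: "galois_structure (?Y k) (B k) (F k) (\<eta> k) (\<epsilon> k) (?E k)" if "k \<le> n" for k
    using assms(3)[OF that] .
  have cells: "extension_cells (?Y k) (?E k)" if "k \<le> n" for k
    using galois_structure.extension_category[OF galois[OF that]] by (rule extension_cells.intro)
  have refl: "ext_reflective (?Y k) (B k) (F k) (\<eta> k) (\<epsilon> k) (?E k)" if "k \<le> n + 1" for k
  proof (cases "k \<le> n")
    case True
    then show ?thesis
      using galois galois_structure.axioms(1) by blast
  next
    case False
    then have "k = n + 1"
      using that by simp
    then show ?thesis
      using assms(7) by simp
  qed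
  have B_Suc: "B (Suc k) = Cov (?Y k) (F k) (\<eta> k) (?E k)" if "k \<le> n" for k
    using assms(5)[of "Suc k"] assms(6) that by (cases "k = n") simp_all
  have base: "regular_category (base_category C)"
    using assms(1) by (simp add: barr_exact_category_def regular_category_base_category)
  \<comment> \<open>The step for the units at \<open>k + 1\<close> uses the Galois structure at \<open>k \<le> n\<close>; hence the
      induction reaches \<open>n + 1\<close>, where only reflectivity is given.\<close>
  have main: "corner_class (?Y k) (?E k) (corners C k) \<and> (\<forall>a \<in> Ob (?Y k). \<eta> k a \<in> corners C k)"
    if "k \<le> n + 1" for k
    using that
  proof (induction k)
    case 0
    have "\<eta> 0 a \<in> Mor (?Y 0)" if "a \<in> Ob (?Y 0)" for a
      using ext_reflective.unit_props(1)[OF refl that] by simp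
    then show ?case
      using regular_category.corner_class_all[OF base] by (simp add: ext_tower_simps)
  next
    case (Suc k)
    then have k: "k \<le> n" and IH: "corner_class (?Y k) (?E k) (corners C k)"
      "\<And>a. a \<in> Ob (?Y k) \<Longrightarrow> \<eta> k a \<in> corners C k"
      by simp_all
    interpret corner_cells "?Y k" "?E k" "corners C k"
      using cells[OF k] IH(1) by (rule corner_cells.intro)
    have coverings: "ext_reflective (Ext (?Y k) (?E k)) (Cov (?Y k) (F k) (\<eta> k) (?E k)) (F (Suc k))
        (\<eta> (Suc k)) (\<epsilon> (Suc k)) (double_extensions (?Y k) (?E k))"
      using refl[OF Suc.prems] B_Suc[OF k] by (simp add: ext_tower_simps)
    have "\<eta> (Suc k) a \<in> corner_squares (?Y k) (?E k) (corners C k)"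
      if "a \<in> Ob (Ext (?Y k) (?E k))" for a
      by (rule unit_corner_squares[OF galois[OF k] assms(4)[OF k] IH coverings that])
    then show ?case
      using corner_class_squares by (simp add: ext_tower_simps del: Ext_simps)
  qed
  interpret R: ext_reflective "?Y (n + 1)" "B (n + 1)" "F (n + 1)" "\<eta> (n + 1)" "\<epsilon> (n + 1)"
    "ext_class C (n + 2)"
    by (rule assms(7))
  have epi: "epi (?Y (n + 1)) f" if "f \<in> ext_class C (n + 2)" for f
    using extension_cells.double_extensions_epi[OF cells[of n]] that
    by (simp add: ext_tower_simps)
  have "corner_class (?Y (n + 1)) (ext_class C (n + 2)) (corners C (n + 1))"
    and "\<And>a. a \<in> Ob (?Y (n + 1)) \<Longrightarrow> \<eta> (n + 1) a \<in> corners C (n + 1)"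
    using main[of "n + 1"] by simp_all
  then show ?thesis
    using R.birkhoff_imp_closed_under_quotients[OF epi]
      R.closed_under_quotients_imp_birkhoff[OF epi] by blast
qed

end
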